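(* Let $C$ be an odd cycle of length $|C|=2p+1$ in the complete graph on $V$, with vertices $c_1,\dots,c_{2p+1}$ in cyclic order, vertex set $V_C$, and $U=V\setminus V_C$. The face $F_C$ of $P_{n,K}$ induced by the 2-chorded cycle inequality $$\sum_{i=1}^{|C|}x_{c_i,c_{i+1}}-\sum_{i=1}^{|C|}x_{c_i,c_{i+2}}\le\left\lfloor\tfrac12|C|\right\rfloor$$ (indices modulo $|C|$) is a facet of $P_{n,K}$ if the following conditions are satisfied: (i) $P_{n,K}$ is full-dimensional; (ii) $|U\cap\{1,2,3\}|\ge 2$; (iii) $2\le p\le n-K-|U\cap\{1,2,3\}|$; (iv) $K\ge 4$.
   Context: $V=\{1,\dots,n\}$ and $E$ is the set of all unordered pairs $ij$ of distinct elements of $V$; $x_{i,j}=x_{j,i}$. A $K$-partition $\pi$ is a collection of $K$ non-empty pairwise disjoint subsets (clusters) of $V$ whose union is $V$. The representative of a cluster is its smallest element. The characteristic vector $x^\pi\in\{0,1\}^{|E|+|V|-3}$ of $\pi$ has components $x_4,\dots,x_n$ and $x_{i,j}$ for $ij\in E$, where $x^\pi_{i,j}=1$ if $i,j$ are in the same cluster and $0$ otherwise, and $x^\pi_u=1$ if $u$ is the representative of its cluster and $0$ otherwise. (Representative variables of vertices $1,2,3$ are not coordinates.) $P_{n,K}\subset\mathbb R^{|E|+|V|-3}$ is the convex hull of the characteristic vectors $x^\pi$ of all $K$-partitions $\pi$ of $V$ (equivalently, of all $0/1$ solutions of the integer formulation of the $K$-partitioning problem). It is full-dimensional (dimension $|E|+|V|-3$)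 if and only if $K\in\{3,\dots,n-2\}$. The 2-chorded cycle inequality of a cycle of length at least $5$ is valid for $P_{n,K}$; $F_C$ is the set of points of $P_{n,K}$ satisfying it with equality. A face is a facet if its dimension is $\dim(P_{n,K})-1$. *)

theory Defs
  imports "HOL-Analysis.Analysis" "HOL-Library.Disjoint_Sets"
begin

text \<open>The vertex set \<open>V\<close> is \<open>{1..n}\<close>; an edge \<open>ij\<close> is the two-element set \<open>{i, j}\<close>, so that
  \<open>x\<^sub>i\<^sub>j = x\<^sub>j\<^sub>i\<close> holds by construction.\<close>

definition edges :: "nat \<Rightarrow> nat set set" where
  "edges n = {e. e \<subseteq> {1..n} \<and> card e = 2}"

datatype coord = Edge "nat set" | Rep nat

definition coords :: "nat \<Rightarrow> coord set" where
  "coords n = Edge ` edges n \<union> Rep ` {4..n}"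

text \<open>The space of dimension \<open>|E| + |V| - 3\<close> is rendered as \<^typ>\<open>real ^ 'd\<close> together with a
  labelling \<open>lab\<close> that is a bijection from the index type \<^typ>\<open>'d\<close> onto \<^term>\<open>coords n\<close>.
  Such a type and labelling exist for every \<open>n\<close> with nonempty \<^term>\<open>coords n\<close>, i.e. for
  \<open>n \<ge> 2\<close>, and \<open>lab\<close> only fixes the order in which the coordinates are listed.\<close>

definition coord_labelling :: "nat \<Rightarrow> ('d \<Rightarrow> coord) \<Rightarrow> bool" where
  "coord_labelling n lab \<longleftrightarrow> bij_betw lab UNIV (coords n)"

definition entry :: "('d::finite \<Rightarrow> coord) \<Rightarrow> real ^ 'd \<Rightarrow> coord \<Rightarrow> real" where
  "entry lab x c = x $ inv lab c"

definition K_partition :: "nat \<Rightarrow> nat \<Rightarrow> nat set set \<Rightarrow> bool" where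
  "K_partition n K \<pi> \<longleftrightarrow> partition_on {1..n} \<pi> \<and> card \<pi> = K"

fun char_coord :: "nat set set \<Rightarrow> coord \<Rightarrow> real" where
  "char_coord \<pi> (Edge e) = (if \<exists>S\<in>\<pi>. e \<subseteq> S then 1 else 0)"
| "char_coord \<pi> (Rep u) = (if \<exists>S\<in>\<pi>. u \<in> S \<and> u = Min S then 1 else 0)"

definition char_vec :: "('d::finite \<Rightarrow> coord) \<Rightarrow> nat set set \<Rightarrow> real ^ 'd" where
  "char_vec lab \<pi> = (\<chi> d. char_coord \<pi> (lab d))"

definition partition_polytope ::
    "('d::finite \<Rightarrow> coord) \<Rightarrow> nat \<Rightarrow> nat \<Rightarrow> (real ^ 'd) set" where
  "partition_polytope lab n K = convex hull (char_vec lab ` {\<pi>. K_partition n K \<pi>})"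

definition full_dimensional :: "'a::euclidean_space set \<Rightarrow> bool" where
  "full_dimensional P \<longleftrightarrow> aff_dim P = int DIM('a)"

text \<open>A cycle in the complete graph on \<open>{1..n}\<close> is given by the list of its vertices in cyclic
  order; \<open>cs ! i\<close> is the vertex \<open>c\<^sub>i\<^sub>+\<^sub>1\<close>, and indices are taken modulo the length.\<close>

definition complete_graph_cycle :: "nat \<Rightarrow> nat list \<Rightarrow> bool" where
  "complete_graph_cycle n cs \<longleftrightarrow> 3 \<le> length cs \<and> distinct cs \<and> set cs \<subseteq> {1..n}"

definition two_chorded_lhs :: "('d::finite \<Rightarrow> coord) \<Rightarrow> nat list \<Rightarrow> real ^ 'd \<Rightarrow> real" where
  "two_chorded_lhs lab cs x =
     (\<Sum>i<length cs. entry lab x (Edge {cs ! i, cs ! ((i + 1) mod length cs)}))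
   - (\<Sum>i<length cs. entry lab x (Edge {cs ! i, cs ! ((i + 2) mod length cs)}))"

definition two_chorded_face ::
    "('d::finite \<Rightarrow> coord) \<Rightarrow> nat \<Rightarrow> nat \<Rightarrow> nat list \<Rightarrow> (real ^ 'd) set" where
  "two_chorded_face lab n K cs =
     {x \<in> partition_polytope lab n K. two_chorded_lhs lab cs x = of_int \<lfloor>real (length cs) / 2\<rfloor>}"

end

theory Submission
  imports Defs
begin

text \<open>
  As the polytope is full-dimensional, it suffices to show that a linear functional which is constant on the
  tight partitions (those attaining equality) and vanishes on the cycle edge \<open>c\<^sub>1c\<^sub>2\<close> is zero;
  applied to \<open>a - \<lambda>A\<close>, with \<open>A\<close> the normal vector of the inequality, this shows that the functionals
  constant on the face form a line. Let \<open>w\<close> be the edge part and \<open>r\<close> the representative part.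

  The basic tight partition isolates one cycle vertex \<open>c\<close> and pairs up the others along the cycle,
  into blocks \<open>P\<^sub>1, \<dots>, P\<^sub>p\<close>; clusters may be unions of the blocks \<open>{c}, P\<^sub>1, \<dots>, P\<^sub>p\<close> that
  never join blocks containing vertices at cycle distance at most two. At most four colours suffice,
  so any number \<open>K \<ge> 4\<close> of clusters up to the number of blocks is available, even
  after removing two vertices outside the cycle. Reinserting the removed vertices in different ways
  yields \<open>r = 0\<close> and \<open>w = 0\<close> on all edges meeting the complement of the cycle.
  Merging two clusters while making one outer vertex a cluster of its own then gives
  \<open>w(c, P\<^sub>j) = 0\<close> for all \<open>j\<close> and \<open>w(P\<^sub>1, P\<^sub>j) = 0\<close> for \<open>3 \<le> j < p\<close>, in every rotation of the
  cycle; these linear equations leave only the line spanned by the inequality itself.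
\<close>

subsection \<open>Weights of clusters\<close>

definition inner_weight :: "(nat set \<Rightarrow> real) \<Rightarrow> nat set \<Rightarrow> real" where
  "inner_weight w S = (\<Sum>e | e \<subseteq> S \<and> card e = 2. w e)"

definition cross_weight :: "(nat set \<Rightarrow> real) \<Rightarrow> nat set \<Rightarrow> nat set \<Rightarrow> real" where
  "cross_weight w A B = (\<Sum>x\<in>A. \<Sum>y\<in>B. w {x, y})"

lemma inner_weight_insert:
  assumes "finite S" "x \<notin> S"
  shows "inner_weight w (insert x S) = inner_weight w S + (\<Sum>y\<in>S. w {x, y})"
proof -
  let ?E = "\<lambda>S. {e. e \<subseteq> S \<and> card e = 2}"
  have fin: "finite (?E S)"
    using assms(1) by (auto intro: finite_subset[of _ "Pow S"])
  have "?E (insert x S) = ?E S \<union> (\<lambda>y. {x, y}) ` S"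
  proof (intro set_eqI iffI)
    fix e assume e: "e \<in> ?E (insert x S)"
    show "e \<in> ?E S \<union> (\<lambda>y. {x, y}) ` S"
    proof (cases "x \<in> e")
      case True
      then obtain y where "e = {x, y}" "x \<noteq> y"
        using e by (auto simp: card_2_iff)
      then show ?thesis using e by auto
    qed (use e in auto)
  qed (use assms(2) in \<open>auto simp: card_2_iff\<close>)
  moreover have "?E S \<inter> (\<lambda>y. {x, y}) ` S = {}"
    using assms(2) by auto
  moreover have "inj_on (\<lambda>y. {x, y}) S"
    by (auto simp: inj_on_def doubleton_eq_iff)
  ultimately show ?thesis
    unfolding inner_weight_def
    using fin assms(1) by (simp add: sum.union_disjoint sum.reindex)
qed

lemma inner_weight_empty [simp]: "inner_weight w {} = 0"
  by (auto simp: inner_weight_def intro!: sum.neutral)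

lemma inner_weight_singleton [simp]: "inner_weight w {x} = 0"
  using inner_weight_insert[of "{}" x w] by simp

lemma inner_weight_Un:
  assumes "finite A" "finite B" "A \<inter> B = {}"
  shows "inner_weight w (A \<union> B) = inner_weight w A + inner_weight w B + cross_weight w A B"
  using assms
proof (induction A)
  case empty
  then show ?case by (simp add: cross_weight_def)
next
  case (insert x A)
  have "inner_weight w (insert x (A \<union> B))
      = inner_weight w (A \<union> B) + (\<Sum>y\<in>A \<union> B. w {x, y})"
    using insert by (intro inner_weight_insert) auto
  also have "(\<Sum>y\<in>A \<union> B. w {x, y}) = (\<Sum>y\<in>A. w {x, y}) + (\<Sum>y\<in>B. w {x, y})"
    using insert by (intro sum.union_disjoint) auto
  finally show ?case
    using insert by (simp add: inner_weight_insert cross_weight_def)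
qed

lemma inner_weight_sum:
  "inner_weight (\<lambda>e. \<Sum>i\<in>I. w i e) S = (\<Sum>i\<in>I. inner_weight (w i) S)"
  unfolding inner_weight_def by (rule sum.swap)

lemma inner_weight_diff:
  "inner_weight (\<lambda>e. w e - w' e) S = inner_weight w S - inner_weight w' S"
  unfolding inner_weight_def by (rule sum_subtractf)

lemma inner_weight_indicator:
  assumes "finite S" "card d = 2"
  shows "inner_weight (\<lambda>e. of_bool (e = d)) S = of_bool (d \<subseteq> S)"
proof -
  have "finite {e. e \<subseteq> S \<and> card e = 2}"
    using assms(1) by (auto intro: finite_subset[of _ "Pow S"])
  then show ?thesis
    using assms(2) by (auto simp: inner_weight_def of_bool_def sum.delta)
qed

subsection \<open>Partitions\<close>

lemma partition_on_finite_parts: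
  assumes "partition_on X \<rho>" "finite X"
  shows "finite \<rho>" and "\<And>A. A \<in> \<rho> \<Longrightarrow> finite A"
  using assms finite_elements[of X \<rho>] finite_subset[of _ X]
  by (auto simp: partition_on_def)

lemma sum_of_bool_within_part:
  assumes "partition_on X \<rho>" "finite \<rho>" "e \<noteq> {}"
  shows "(\<Sum>S\<in>\<rho>. of_bool (e \<subseteq> S)) = (of_bool (\<exists>S\<in>\<rho>. e \<subseteq> S) :: real)"
proof (cases "\<exists>S\<in>\<rho>. e \<subseteq> S")
  case True
  then obtain S where S: "S \<in> \<rho>" "e \<subseteq> S" by blast
  have uniq: "S' = S" if "S' \<in> \<rho>" "e \<subseteq> S'" for S'
  proof (rule ccontr)
    assume "S' \<noteq> S"
    then have "S' \<inter> S = {}"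
      using that(1) S(1) assms(1) disjointD by (metis partition_on_def)
    then show False using that(2) S(2) assms(3) by blast
  qed
  have "(\<Sum>S'\<in>\<rho>. of_bool (e \<subseteq> S')) = (\<Sum>S'\<in>\<rho>. if S' = S then 1 else 0 :: real)"
  proof (intro sum.cong refl)
    fix S' assume "S' \<in> \<rho>"
    then have "e \<subseteq> S' \<longleftrightarrow> S' = S" using uniq[of S'] S by blast
    then show "of_bool (e \<subseteq> S') = (if S' = S then 1 else 0 :: real)" by simp
  qed
  then show ?thesis using True S assms(2) by simp
next
  case False
  then show ?thesis by (auto intro!: sum.neutral)
qed

definition add_vertex :: "nat \<Rightarrow> nat set \<Rightarrow> nat set set \<Rightarrow> nat set set" where
  "add_vertex v A \<rho> = insert (insert v A) (\<rho> - {A})"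

definition merge_parts :: "nat set \<Rightarrow> nat set \<Rightarrow> nat set set \<Rightarrow> nat set set" where
  "merge_parts A B \<rho> = insert (A \<union> B) (\<rho> - {A, B})"

lemma partition_on_fresh:
  assumes "partition_on X \<rho>" "v \<notin> X" "A \<in> \<rho>"
  shows "v \<notin> A"
  using assms by (auto simp: partition_on_def)

lemma add_vertex_partition:
  assumes \<rho>: "partition_on X \<rho>" and fin: "finite X" and A: "A \<in> \<rho>" and v: "v \<notin> X"
  shows "partition_on (insert v X) (add_vertex v A \<rho>)"
    and "card (add_vertex v A \<rho>) = card \<rho>"
    and "sum g (add_vertex v A \<rho>) = sum g \<rho> - g A + (g (insert v A) :: real)"
proof -
  have new: "insert v A \<notin> \<rho>" using partition_on_fresh[OF \<rho> v] by blast
  have fin\<rho>: "finite \<rho>" using partition_on_finite_parts[OF \<rho> fin] by blast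
  have disj: "B \<inter> A = {}" if "B \<in> \<rho>" "B \<noteq> A" for B
    using that A \<rho> by (auto simp: partition_on_def dest: disjointD)
  show "partition_on (insert v X) (add_vertex v A \<rho>)"
  proof (rule partition_onI)
    show "\<Union> (add_vertex v A \<rho>) = insert v X"
      using A \<rho> by (auto simp: add_vertex_def partition_on_def)
    show "{} \<notin> add_vertex v A \<rho>"
      using \<rho> by (auto simp: add_vertex_def partition_on_def)
    fix P Q assume "P \<in> add_vertex v A \<rho>" "Q \<in> add_vertex v A \<rho>" "P \<noteq> Q"
    then show "disjnt P Q"
      using disj partition_on_fresh[OF \<rho> v] \<rho>
      by (auto simp: add_vertex_def partition_on_def disjnt_def dest: disjointD)
  qed
  show "card (add_vertex v A \<rho>) = card \<rho>"
    using A fin\<rho> new card_Suc_Diff1[OF fin\<rho> A] by (simp add: add_vertex_def)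
  show "sum g (add_vertex v A \<rho>) = sum g \<rho> - g A + g (insert v A)"
    using A fin\<rho> new sum_diff1[OF fin\<rho>, of g A] by (simp add: add_vertex_def)
qed

lemma insert_singleton_partition:
  assumes \<rho>: "partition_on X \<rho>" and fin: "finite X" and v: "v \<notin> X"
  shows "partition_on (insert v X) (insert {v} \<rho>)"
    and "card (insert {v} \<rho>) = Suc (card \<rho>)"
    and "sum g (insert {v} \<rho>) = g {v} + (sum g \<rho> :: real)"
proof -
  have new: "{v} \<notin> \<rho>" using partition_on_fresh[OF \<rho> v] by blast
  have fin\<rho>: "finite \<rho>" using partition_on_finite_parts[OF \<rho> fin] by blast
  show "partition_on (insert v X) (insert {v} \<rho>)"
    using \<rho> v partition_on_fresh[OF \<rho> v]
    by (intro partition_onI) (auto simp: partition_on_def disjnt_def dest: disjointD)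
  show "card (insert {v} \<rho>) = Suc (card \<rho>)" "sum g (insert {v} \<rho>) = g {v} + sum g \<rho>"
    using fin\<rho> new by simp_all
qed

lemma merge_parts_partition:
  assumes \<rho>: "partition_on X \<rho>" and fin: "finite X" and AB: "A \<in> \<rho>" "B \<in> \<rho>" "A \<noteq> B"
  shows "partition_on X (merge_parts A B \<rho>)"
    and "Suc (card (merge_parts A B \<rho>)) = card \<rho>"
    and "sum g (merge_parts A B \<rho>) = sum g \<rho> - g A - g B + (g (A \<union> B) :: real)"
proof -
  have fin\<rho>: "finite \<rho>" using partition_on_finite_parts[OF \<rho> fin] by blast
  have disj: "P \<inter> Q = {}" if "P \<in> \<rho>" "Q \<in> \<rho>" "P \<noteq> Q" for P Q
    using that \<rho> by (auto simp: partition_on_def dest: disjointD)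
  have ne: "P \<noteq> {}" if "P \<in> \<rho>" for P
    using that \<rho> by (auto simp: partition_on_def)
  have new: "A \<union> B \<notin> \<rho>"
  proof
    assume "A \<union> B \<in> \<rho>"
    then show False
      using disj[of "A \<union> B" A] disj[of "A \<union> B" B] AB ne[of A] ne[of B] disj[of A B] by blast
  qed
  show "partition_on X (merge_parts A B \<rho>)"
  proof (rule partition_onI)
    show "\<Union> (merge_parts A B \<rho>) = X"
      using AB \<rho> by (auto simp: merge_parts_def partition_on_def)
    show "{} \<notin> merge_parts A B \<rho>"
      using ne AB by (auto simp: merge_parts_def)
    have union: "disjnt (A \<union> B) C" if "C \<in> \<rho> - {A, B}" for C
      using disj[of A C] disj[of B C] that AB by (auto simp: disjnt_def)
    fix P Q assume "P \<in> merge_parts A B \<rho>" "Q \<in> merge_parts A B \<rho>" "P \<noteq> Q"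
    then consider "P = A \<union> B" "Q \<in> \<rho> - {A, B}" | "Q = A \<union> B" "P \<in> \<rho> - {A, B}"
      | "P \<in> \<rho>" "Q \<in> \<rho>"
      unfolding merge_parts_def by blast
    then show "disjnt P Q"
    proof cases
      case 1
      then show ?thesis using union by simp
    next
      case 2
      then show ?thesis using union by (simp add: disjnt_sym)
    next
      case 3
      then show ?thesis using disj \<open>P \<noteq> Q\<close> by (simp add: disjnt_def)
    qed
  qed
  have c: "card (\<rho> - {A, B}) + 2 = card \<rho>"
    using AB fin\<rho> card_Diff_subset[of "{A, B}" \<rho>] card_mono[of \<rho> "{A, B}"] by simp
  then show "Suc (card (merge_parts A B \<rho>)) = card \<rho>"
    using fin\<rho> new by (simp add: merge_parts_def)
  have "sum g (\<rho> - {A, B}) = sum g \<rho> - g A - g B"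
    using AB fin\<rho> sum_diff[of \<rho> "{A, B}" g] by simp
  then show "sum g (merge_parts A B \<rho>) = sum g \<rho> - g A - g B + g (A \<union> B)"
    using fin\<rho> new by (simp add: merge_parts_def)
qed

lemma refine_to_card:
  fixes \<kappa> :: "'a \<Rightarrow> nat"
  assumes fin: "finite X" and lo: "card (\<kappa> ` X) \<le> k" and hi: "k \<le> card X"
  shows "\<exists>g :: 'a \<Rightarrow> nat. card (g ` X) = k \<and> (\<forall>x\<in>X. \<forall>y\<in>X. g x = g y \<longrightarrow> \<kappa> x = \<kappa> y)"
  using lo hi
proof (induction k rule: dec_induct)
  case base
  then show ?case by blast
next
  case (step k)
  then obtain g :: "'a \<Rightarrow> nat" where g: "card (g ` X) = k"
      "\<And>x y. \<lbrakk>x \<in> X; y \<in> X; g x = g y\<rbrakk> \<Longrightarrow> \<kappa> x = \<kappa> y"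
    using Suc_leD by metis
  have "\<not> inj_on g X" using g(1) step card_image[of g X] by auto
  then obtain x y where xy: "x \<in> X" "y \<in> X" "x \<noteq> y" "g x = g y" by (auto simp: inj_on_def)
  obtain z where z: "z \<notin> g ` X"
    using ex_new_if_finite[OF infinite_UNIV_nat] fin by blast
  have "(g(x := z)) ` X = insert z (g ` X)"
  proof -
    have "g ` (X - {x}) = g ` X"
      using xy by (auto intro: rev_image_eqI[of y])
    moreover have "(g(x := z)) ` X = insert z (g ` (X - {x}))" using xy(1) by auto
    ultimately show ?thesis by simp
  qed
  then have "card ((g(x := z)) ` X) = Suc k"
    using g(1) z fin by (metis card_insert_disjoint finite_imageI)
  moreover have "\<kappa> u = \<kappa> v" if "u \<in> X" "v \<in> X" "(g(x := z)) u = (g(x := z)) v" for u v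
    using that z g(2)[of u v] by (auto split: if_splits)
  ultimately show ?case by blast
qed

lemma partition_fibres:
  fixes h :: "nat \<Rightarrow> nat"
  assumes "finite X"
  defines "\<rho> \<equiv> (\<lambda>b. {v \<in> X. h v = b}) ` h ` X"
  shows "partition_on X \<rho>" and "card \<rho> = card (h ` X)"
proof -
  show "partition_on X \<rho>"
    unfolding \<rho>_def by (intro partition_onI) (auto simp: disjnt_def)
  have "inj_on (\<lambda>b. {v \<in> X. h v = b}) (h ` X)" by (auto simp: inj_on_def)
  then show "card \<rho> = card (h ` X)" unfolding \<rho>_def by (rule card_image)
qed

subsection \<open>The two-chorded cycle inequality\<close>

definition two_chorded_weight :: "nat list \<Rightarrow> nat set \<Rightarrow> real" where
  "two_chorded_weight cs e =
     (\<Sum>i<length cs. of_bool (e = {cs ! i, cs ! ((i + 1) mod length cs)}))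
   - (\<Sum>i<length cs. of_bool (e = {cs ! i, cs ! ((i + 2) mod length cs)}))"

definition two_chorded_value :: "nat list \<Rightarrow> nat set set \<Rightarrow> real" where
  "two_chorded_value cs \<rho> = (\<Sum>S\<in>\<rho>. inner_weight (two_chorded_weight cs) S)"

lemma sum_mod_shift:
  fixes f :: "nat \<Rightarrow> real"
  assumes "0 < l"
  shows "(\<Sum>i<l. f ((i + k) mod l)) = (\<Sum>i<l. f i)"
proof -
  have inj: "inj_on (\<lambda>i. (i + k) mod l) {..<l}"
  proof (rule inj_onI)
    fix x y assume xy: "x \<in> {..<l}" "y \<in> {..<l}" "(x + k) mod l = (y + k) mod l"
    then obtain q q' where "x + k + l * q = y + k + l * q'"
      by (auto simp: nat_mod_eq_iff)
    then have "x mod l = y mod l" by (auto simp: nat_mod_eq_iff)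
    then show "x = y" using xy by simp
  qed
  have "(\<lambda>i. (i + k) mod l) ` {..<l} = {..<l}"
    using assms inj by (intro endo_inj_surj) auto
  with inj have "bij_betw (\<lambda>i. (i + k) mod l) {..<l} {..<l}"
    by (auto simp: bij_betw_def)
  then show ?thesis by (rule sum.reindex_bij_betw)
qed

lemma two_chorded_weight_rotate:
  "two_chorded_weight (rotate k cs) = two_chorded_weight cs"
proof (cases "cs = []")
  case False
  then have l: "0 < length cs" by simp
  have "(\<Sum>i<length cs. of_bool (e = {rotate k cs ! i, rotate k cs ! ((i + d) mod length cs)}))
      = (\<Sum>i<length cs. of_bool (e = {cs ! i, cs ! ((i + d) mod length cs)}) :: real)" for e d
  proof -
    have "(\<Sum>i<length cs. of_bool (e = {rotate k cs ! i, rotate k cs ! ((i + d) mod length cs)}))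
        = (\<Sum>i<length cs. of_bool (e = {cs ! ((i + k) mod length cs),
             cs ! (((i + k) mod length cs + d) mod length cs)}) :: real)"
      using l by (intro sum.cong) (auto simp: nth_rotate mod_simps ac_simps)
    then show ?thesis
      using sum_mod_shift[OF l, of "\<lambda>i. of_bool (e = {cs ! i, cs ! ((i + d) mod length cs)})" k]
      by simp
  qed
  from this[where d = 1] this[where d = 2] show ?thesis
    unfolding two_chorded_weight_def fun_eq_iff length_rotate by simp
qed simp

lemma two_chorded_weight_outside:
  assumes "x \<notin> set cs"
  shows "two_chorded_weight cs {x, y} = 0"
proof -
  have "{x, y} \<noteq> {cs ! i, cs ! (k mod length cs)}" if "i < length cs" for i k
  proof -
    have "0 < length cs" using that by linarith
    then have "k mod length cs < length cs" by simp
    then show ?thesis using that assms nth_mem[of i cs] nth_mem[of "k mod length cs" cs]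
      by (metis doubleton_eq_iff)
  qed
  then show ?thesis by (simp add: two_chorded_weight_def)
qed

locale odd_cycle =
  fixes n K p :: nat and cs :: "nat list"
  assumes distinct_cs: "distinct cs" and cs_subset: "set cs \<subseteq> {1..n}"
    and length_cs: "length cs = 2 * p + 1" and p_ge: "2 \<le> p"
    and K_ge: "4 \<le> K" and K_le: "K + p + 2 \<le> n"
begin

lemma rotate: "odd_cycle n K p (rotate k cs)"
  using distinct_cs cs_subset length_cs p_ge K_ge K_le by unfold_locales auto

lemma mod_shift_neq:
  assumes "i < 2 * p + 1" "d = 1 \<or> d = 2"
  shows "(i + d) mod (2 * p + 1) \<noteq> i"
proof (cases "i + d < 2 * p + 1")
  case False
  then have "(i + d) mod (2 * p + 1) = i + d - (2 * p + 1)"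
    using assms p_ge by (subst le_mod_geq) auto
  then show ?thesis using assms p_ge by auto
qed (use assms in auto)

lemma nth_cs_eq_iff: "i < 2 * p + 1 \<Longrightarrow> k < 2 * p + 1 \<Longrightarrow> cs ! i = cs ! k \<longleftrightarrow> i = k"
  using nth_eq_iff_index_eq[OF distinct_cs] length_cs by simp

lemma card_cycle_pair:
  assumes "i < 2 * p + 1" "d = 1 \<or> d = 2"
  shows "card {cs ! i, cs ! ((i + d) mod (2 * p + 1))} = 2"
  using mod_shift_neq[OF assms] assms nth_cs_eq_iff[of i "(i + d) mod (2 * p + 1)"]
  by (auto simp: card_2_iff)

lemma inner_weight_two_chorded:
  assumes "finite S"
  shows "inner_weight (two_chorded_weight cs) S =
     (\<Sum>i<2 * p + 1. of_bool ({cs ! i, cs ! ((i + 1) mod (2 * p + 1))} \<subseteq> S))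
   - (\<Sum>i<2 * p + 1. of_bool ({cs ! i, cs ! ((i + 2) mod (2 * p + 1))} \<subseteq> S))"
proof -
  have "inner_weight (\<lambda>e. \<Sum>i<2 * p + 1. of_bool (e = {cs ! i, cs ! ((i + d) mod (2 * p + 1))})) S
      = (\<Sum>i<2 * p + 1. of_bool ({cs ! i, cs ! ((i + d) mod (2 * p + 1))} \<subseteq> S))"
    if "d = 1 \<or> d = 2" for d
    unfolding inner_weight_sum
    by (intro sum.cong refl inner_weight_indicator[OF assms] card_cycle_pair that) simp
  from this[of 1] this[of 2] show ?thesis
    unfolding two_chorded_weight_def length_cs by (subst inner_weight_diff) simp
qed

lemma two_chorded_value_eq:
  assumes "partition_on X \<rho>" "finite X"
  shows "two_chorded_value cs \<rho> =
     (\<Sum>i<2 * p + 1. of_bool (\<exists>S\<in>\<rho>. {cs ! i, cs ! ((i + 1) mod (2 * p + 1))} \<subseteq> S))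
   - (\<Sum>i<2 * p + 1. of_bool (\<exists>S\<in>\<rho>. {cs ! i, cs ! ((i + 2) mod (2 * p + 1))} \<subseteq> S))"
proof -
  note fin = partition_on_finite_parts[OF assms]
  have "(\<Sum>S\<in>\<rho>. \<Sum>i<2 * p + 1. of_bool ({cs ! i, cs ! ((i + d) mod (2 * p + 1))} \<subseteq> S))
      = (\<Sum>i<2 * p + 1. of_bool (\<exists>S\<in>\<rho>. {cs ! i, cs ! ((i + d) mod (2 * p + 1))} \<subseteq> S) :: real)" for d
    by (subst sum.swap) (intro sum.cong refl sum_of_bool_within_part[OF assms(1) fin(1)], simp)
  then show ?thesis
    unfolding two_chorded_value_def
    by (simp only: inner_weight_two_chorded[OF fin(2)] sum_subtractf cong: sum.cong)
qed

text \<open>Sum the triangle inequalities for three consecutive vertices and the nonnegativity of the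
  chords, halve, and round down.\<close>

lemma two_chorded_value_le:
  assumes \<rho>: "partition_on X \<rho>" and fin: "finite X"
  shows "two_chorded_value cs \<rho> \<le> real p"
proof -
  let ?L = "2 * p + 1"
  define s :: "nat \<Rightarrow> nat \<Rightarrow> bool" where "s i k \<longleftrightarrow> (\<exists>S\<in>\<rho>. {cs ! i, cs ! k} \<subseteq> S)" for i k
  define f where "f d i = (of_bool (s i ((i + d) mod ?L)) :: int)" for d i
  define g where "g d = (\<Sum>i<?L. f d i)" for d
  have trans: "s i k" if "s i j" "s j k" for i j k
  proof -
    from that obtain A B where "A \<in> \<rho>" "B \<in> \<rho>" "{cs ! i, cs ! j} \<subseteq> A" "{cs ! j, cs ! k} \<subseteq> B"
      by (auto simp: s_def)
    moreover from this have "A = B"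
      using \<rho> disjointD[of \<rho> A B] by (auto simp: partition_on_def)
    ultimately show ?thesis by (auto simp: s_def)
  qed
  have tri: "f 1 i + f 1 ((i + 1) mod ?L) - f 2 i \<le> 1" for i
  proof -
    have "((i + 1) mod ?L + 1) mod ?L = (i + 2) mod ?L"
      by (metis add.assoc mod_add_left_eq one_add_one)
    then show ?thesis using trans[of i "(i + 1) mod ?L" "(i + 2) mod ?L"]
      by (auto simp: f_def)
  qed
  have "real_of_int (\<Sum>i<?L. f 1 ((i + 1) mod ?L)) = real_of_int (g 1)"
    using sum_mod_shift[of ?L "\<lambda>i. real_of_int (f 1 i)" 1] by (simp add: g_def)
  then have shift: "(\<Sum>i<?L. f 1 ((i + 1) mod ?L)) = g 1" by linarith
  have "(\<Sum>i<?L. f 1 i + f 1 ((i + 1) mod ?L) - f 2 i) \<le> (\<Sum>i<?L. 1)"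
    by (intro sum_mono tri)
  then have "g 1 + g 1 - g 2 \<le> int ?L"
    using shift by (simp add: sum.distrib sum_subtractf g_def)
  moreover have "0 \<le> g 2" unfolding g_def f_def by (intro sum_nonneg) simp
  ultimately have "g 1 - g 2 \<le> int p" by linarith
  moreover have "two_chorded_value cs \<rho> = real_of_int (g 1 - g 2)"
    by (simp add: two_chorded_value_eq[OF \<rho> fin] g_def f_def s_def)
  ultimately show ?thesis by linarith
qed

subsection \<open>Tight partitions\<close>

text \<open>The pairs matched along the cycle when \<open>cs ! 0\<close> is left unmatched.\<close>

definition block :: "nat \<Rightarrow> nat set" where
  "block j = {cs ! (2 * j - 1), cs ! (2 * j)}"

lemma two_chorded_weight_nth:
  assumes "i < 2 * p + 1" "k < 2 * p + 1" "i \<noteq> k"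
  shows "two_chorded_weight cs {cs ! i, cs ! k} =
      of_bool (k = (i + 1) mod (2 * p + 1)) + of_bool (i = (k + 1) mod (2 * p + 1))
    - (of_bool (k = (i + 2) mod (2 * p + 1)) + of_bool (i = (k + 2) mod (2 * p + 1)))"
proof -
  have "(\<Sum>j<2 * p + 1. of_bool ({cs ! i, cs ! k} = {cs ! j, cs ! ((j + d) mod (2 * p + 1))}))
     = (of_bool (k = (i + d) mod (2 * p + 1)) + of_bool (i = (k + d) mod (2 * p + 1)) :: real)" for d
  proof -
    have "(\<Sum>j<2 * p + 1. of_bool ({cs ! i, cs ! k} = {cs ! j, cs ! ((j + d) mod (2 * p + 1))}))
      = (\<Sum>j<2 * p + 1. (if j = i then of_bool (k = (i + d) mod (2 * p + 1)) else 0)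
          + (if j = k then of_bool (i = (k + d) mod (2 * p + 1)) else 0) :: real)"
    proof (intro sum.cong refl)
      fix j assume j: "j \<in> {..<2 * p + 1}"
      have "(j + d) mod (2 * p + 1) < 2 * p + 1" by simp
      with j have eq: "{cs ! i, cs ! k} = {cs ! j, cs ! ((j + d) mod (2 * p + 1))} \<longleftrightarrow>
          i = j \<and> k = (j + d) mod (2 * p + 1) \<or> i = (j + d) mod (2 * p + 1) \<and> k = j"
        using assms(1,2) by (simp only: doubleton_eq_iff nth_cs_eq_iff lessThan_iff)
      show "of_bool ({cs ! i, cs ! k} = {cs ! j, cs ! ((j + d) mod (2 * p + 1))}) =
          (if j = i then of_bool (k = (i + d) mod (2 * p + 1)) else 0)
          + (if j = k then of_bool (i = (k + d) mod (2 * p + 1)) else 0 :: real)"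
        unfolding eq using assms(3) by auto
    qed
    also have "\<dots> = of_bool (k = (i + d) mod (2 * p + 1)) + of_bool (i = (k + d) mod (2 * p + 1))"
      using assms by (simp only: sum.distrib sum.delta finite_lessThan lessThan_iff if_True)
    finally show ?thesis .
  qed
  then show ?thesis unfolding two_chorded_weight_def length_cs by (simp only:)
qed

lemma two_chorded_weight_from_first:
  assumes "0 < k" "k < 2 * p + 1"
  shows "two_chorded_weight cs {cs ! 0, cs ! k} =
    of_bool (k = 1) + of_bool (k = 2 * p) - (of_bool (k = 2) + of_bool (k = 2 * p - 1))"
proof -
  have "0 = (k + d) mod (2 * p + 1) \<longleftrightarrow> k + d = 2 * p + 1" if "d = 1 \<or> d = 2" for d
  proof (cases "k + d < 2 * p + 1")
    case False
    then have "(k + d) mod (2 * p + 1) = k + d - (2 * p + 1)"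
      using assms that p_ge by (subst le_mod_geq) auto
    then show ?thesis using False by linarith
  qed (use assms in auto)
  from this[of 1] this[of 2] have "0 = (k + 1) mod (2 * p + 1) \<longleftrightarrow> k = 2 * p"
      "0 = (k + 2) mod (2 * p + 1) \<longleftrightarrow> k = 2 * p - 1"
    using p_ge by linarith+
  moreover have "(0 + 1) mod (2 * p + 1) = 1" "(0 + 2) mod (2 * p + 1) = 2" using p_ge by auto
  ultimately show ?thesis using two_chorded_weight_nth[of 0 k] assms by (simp only:)
qed

lemma two_chorded_weight_first_edge: "two_chorded_weight cs {cs ! 0, cs ! 1} = 1"
  using p_ge two_chorded_weight_from_first[of 1] by auto

lemma cross_weight_doubleton:
  "i < 2 * p + 1 \<Longrightarrow> k < 2 * p + 1 \<Longrightarrow> i \<noteq> k \<Longrightarrow>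
    cross_weight w A {cs ! i, cs ! k} = (\<Sum>x\<in>A. w {x, cs ! i} + w {x, cs ! k})"
  by (simp add: cross_weight_def nth_cs_eq_iff)

lemma cross_weight_block:
  assumes "1 \<le> j" "j \<le> p"
  shows "cross_weight w A (block j) = (\<Sum>x\<in>A. w {x, cs ! (2 * j - 1)} + w {x, cs ! (2 * j)})"
  unfolding block_def using assms by (intro cross_weight_doubleton) auto

lemma two_chorded_cross_first_block:
  assumes "1 \<le> j" "j \<le> p"
  shows "cross_weight (two_chorded_weight cs) {cs ! 0} (block j) = 0"
proof -
  have "2 * j - 1 = 1 \<longleftrightarrow> j = 1" "2 * j - 1 \<noteq> 2 * p" "2 * j - 1 \<noteq> 2"
      "2 * j - 1 = 2 * p - 1 \<longleftrightarrow> j = p" "2 * j \<noteq> 1" "2 * j \<noteq> 2 * p - 1"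
    using assms p_ge by presburger+
  then have "two_chorded_weight cs {cs ! 0, cs ! (2 * j - 1)} = of_bool (j = 1) - of_bool (j = p)"
      "two_chorded_weight cs {cs ! 0, cs ! (2 * j)} = of_bool (j = p) - of_bool (j = 1)"
    using assms two_chorded_weight_from_first[of "2 * j - 1"] two_chorded_weight_from_first[of "2 * j"]
    by simp_all
  then show ?thesis by (simp add: cross_weight_block[OF assms])
qed

lemma two_chorded_cross_blocks:
  assumes "3 \<le> j" "j < p"
  shows "cross_weight (two_chorded_weight cs) (block 1) (block j) = 0"
proof -
  have "two_chorded_weight cs {cs ! i, cs ! k} = 0"
    if ik: "i = 1 \<or> i = 2" "k = 2 * j - 1 \<or> k = 2 * j" for i k
  proof -
    have "i \<le> 2" "5 \<le> k" "k + 2 < 2 * p + 1" using assms ik by auto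
    then show ?thesis using ik(1) by (subst two_chorded_weight_nth) auto
  qed
  from this[of 1] this[of 2] show ?thesis
    using assms by (subst cross_weight_block) (auto simp: block_def intro!: sum.neutral)
qed

lemma sum_odd: "(\<Sum>i<2 * k + 1. of_bool (odd i)) = real k"
proof (induction k)
  case (Suc k)
  have *: "2 * Suc k + 1 = Suc (Suc (2 * k + 1))" by simp
  show ?case unfolding * sum.lessThan_Suc Suc.IH by simp
qed simp

text \<open>A colouring \<open>\<kappa>\<close> of block numbers: \<open>0\<close> stands for \<open>{cs ! 0}\<close>, \<open>1, \<dots>, p\<close> for the pairs, and
  \<open>p + 1 + u\<close> for the vertex \<open>u\<close> outside the cycle. The partition obtained lies between the blocks and
  the colour classes, so a block with a colour of its own is a cluster.\<close>

lemma coloured_partition: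
  fixes \<kappa> :: "nat \<Rightarrow> nat"
  assumes D: "D \<subseteq> {1..n} - set cs" "card D \<le> 2"
    and \<kappa>: "\<And>b. \<kappa> b < 4" "\<And>i. i < p \<Longrightarrow> \<kappa> i \<noteq> \<kappa> (Suc i)" "\<kappa> 0 \<noteq> \<kappa> p" "\<kappa> 1 \<noteq> \<kappa> p"
  obtains \<rho> where "partition_on ({1..n} - D) \<rho>" "card \<rho> = K" "two_chorded_value cs \<rho> = real p"
    "(\<And>b. \<kappa> b = \<kappa> 0 \<Longrightarrow> b = 0) \<Longrightarrow> {cs ! 0} \<in> \<rho>"
    "\<And>j. \<lbrakk>1 \<le> j; j \<le> p; \<And>b. \<kappa> b = \<kappa> j \<Longrightarrow> b = j\<rbrakk> \<Longrightarrow> block j \<in> \<rho>"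
    "\<And>u. \<lbrakk>u \<in> {1..n} - set cs - D; \<And>b. \<kappa> b = \<kappa> (p + 1 + u) \<Longrightarrow> b = p + 1 + u\<rbrakk> \<Longrightarrow> {u} \<in> \<rho>"
proof -
  let ?L = "2 * p + 1"
  define X where "X = {1..n} - D"
  have csX: "set cs \<subseteq> X" using cs_subset D unfolding X_def by blast
  have cs_in: "cs ! i \<in> set cs" if "i < ?L" for i using that length_cs by simp
  define h where "h v = (if v \<in> set cs then (inv_into {..<?L} ((!) cs) v + 1) div 2 else p + 1 + v)"
    for v
  have inj: "inj_on ((!) cs) {..<?L}" by (auto simp: inj_on_def nth_cs_eq_iff)
  have h_cs: "h (cs ! i) = (i + 1) div 2" if "i < ?L" for i
    using that cs_in[OF that] inv_into_f_f[OF inj, of i] by (simp add: h_def)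
  have h_out: "h u = p + 1 + u" if "u \<notin> set cs" for u using that by (simp add: h_def)
  have finX: "finite X" by (simp add: X_def)
  define B where "B = h ` X"
  have finB: "finite B" using finX by (simp add: B_def)
  have "card (set cs) = ?L" using distinct_card[OF distinct_cs] length_cs by simp
  then have "card ({1..n} - set cs) = n - ?L" using cs_subset by (simp add: card_Diff_subset)
  moreover have "finite D" using D(1) finite_subset by blast
  ultimately have cU: "n - ?L - 2 \<le> card (X - set cs)"
    using D card_Diff_subset[of D "{1..n} - set cs"] unfolding X_def
    by (simp add: set_diff_eq conj_ac)
  have sub: "{..p} \<union> (\<lambda>u. p + 1 + u) ` (X - set cs) \<subseteq> B"
  proof (intro Un_least subsetI)
    fix b assume "b \<in> {..p}"
    then have "h (cs ! (2 * b)) = b" "2 * b < ?L" using h_cs[of "2 * b"] by auto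
    then show "b \<in> B" unfolding B_def using csX cs_in by (metis imageI subsetD)
  next
    fix b assume "b \<in> (\<lambda>u. p + 1 + u) ` (X - set cs)"
    then show "b \<in> B" unfolding B_def using h_out by force
  qed
  have "card ({..p} \<union> (\<lambda>u. p + 1 + u) ` (X - set cs)) = p + 1 + card (X - set cs)"
    using finX by (subst card_Un_disjoint) (auto intro: card_image simp: inj_on_def)
  then have "K \<le> card B" using card_mono[OF finB sub] cU K_le p_ge K_ge by linarith
  moreover have "card (\<kappa> ` B) \<le> K"
  proof -
    have "\<kappa> ` B \<subseteq> {..<4}" using \<kappa>(1) by auto
    then have "card (\<kappa> ` B) \<le> 4" using card_mono[of "{..<4::nat}"] by fastforce
    then show ?thesis using K_ge by simp
  qed
  ultimately obtain g :: "nat \<Rightarrow> nat" where g: "card (g ` B) = K"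
      "\<And>x y. \<lbrakk>x \<in> B; y \<in> B; g x = g y\<rbrakk> \<Longrightarrow> \<kappa> x = \<kappa> y"
    using refine_to_card[OF finB] by metis
  define \<rho> where "\<rho> = (\<lambda>b. {v \<in> X. (g \<circ> h) v = b}) ` (g \<circ> h) ` X"
  have part: "partition_on X \<rho>" and card\<rho>: "card \<rho> = K"
    using partition_fibres[OF finX, of "g \<circ> h"] g(1) unfolding \<rho>_def B_def
    by (simp_all add: image_comp)
  have same: "(\<exists>S\<in>\<rho>. {x, y} \<subseteq> S) \<longleftrightarrow> g (h x) = g (h y)" if "x \<in> X" "y \<in> X" for x y
    using that unfolding \<rho>_def by auto
  have hB: "h (cs ! i) \<in> B" if "i < ?L" for i
    using cs_in[OF that] csX unfolding B_def by blast
  have same_cs: "(\<exists>S\<in>\<rho>. {cs ! i, cs ! k} \<subseteq> S) \<longleftrightarrow> g (h (cs ! i)) = g (h (cs ! k))"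
    if "i < ?L" "k < ?L" for i k
    by (intro same subsetD[OF csX] cs_in that)
  have close: "g (h (cs ! i)) = g (h (cs ! k)) \<longleftrightarrow> h (cs ! i) = h (cs ! k)"
    if "i < ?L" "k < ?L" "h (cs ! i) \<noteq> h (cs ! k) \<Longrightarrow> \<kappa> (h (cs ! i)) \<noteq> \<kappa> (h (cs ! k))" for i k
    using that(3) g(2)[OF hB[OF that(1)] hB[OF that(2)]] by auto
  have s1: "(\<exists>S\<in>\<rho>. {cs ! i, cs ! ((i + 1) mod ?L)} \<subseteq> S) \<longleftrightarrow> odd i" if i: "i < ?L" for i
  proof -
    define k where "k = (i + 1) mod ?L"
    have k: "k < ?L" by (simp add: k_def)
    define m where "m = i div 2"
    have "i = 2 * m \<or> i = 2 * m + 1" unfolding m_def by presburger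
    then consider "i = 2 * p" | "i = 2 * m" "m < p" | "i = 2 * m + 1" "m < p"
      using i by linarith
    then have "g (h (cs ! i)) = g (h (cs ! k)) \<longleftrightarrow> odd i"
    proof cases
      case 1
      then have "h (cs ! i) = p" "h (cs ! k) = 0" using h_cs[OF i] h_cs[OF k] by (auto simp: k_def)
      then show ?thesis using 1 close[OF i k] \<kappa>(3) p_ge by auto
    next
      case 2
      then have "h (cs ! i) = m" "h (cs ! k) = Suc m" using h_cs[OF i] h_cs[OF k] by (auto simp: k_def)
      then show ?thesis using 2 close[OF i k] \<kappa>(2)[of m] by auto
    next
      case 3
      then have "h (cs ! i) = Suc m" "h (cs ! k) = Suc m" using h_cs[OF i] h_cs[OF k] by (auto simp: k_def)
      then show ?thesis using 3 by auto
    qed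
    then show ?thesis using same_cs[OF i k] unfolding k_def by (simp only:)
  qed
  have s2: "\<not> (\<exists>S\<in>\<rho>. {cs ! i, cs ! ((i + 2) mod ?L)} \<subseteq> S)" if i: "i < ?L" for i
  proof -
    define k where "k = (i + 2) mod ?L"
    have k: "k < ?L" by (simp add: k_def)
    consider "i = 2 * p" | "i = 2 * p - 1" | "i < 2 * p - 1" using i by linarith
    then have "g (h (cs ! i)) \<noteq> g (h (cs ! k))"
    proof cases
      case 1
      then have "k = 1" using p_ge by (simp add: k_def le_mod_geq)
      with 1 have "h (cs ! i) = p" "h (cs ! k) = 1" using h_cs[OF i] h_cs[OF k] by auto
      then show ?thesis using close[OF i k] \<kappa>(4) p_ge by auto
    next
      case 2
      then have "i + 2 = ?L" using p_ge by simp
      then have "k = 0" unfolding k_def by (simp only: mod_self)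
      with 2 have "h (cs ! i) = p" "h (cs ! k) = 0" using h_cs[OF i] h_cs[OF k] p_ge by auto
      then show ?thesis using close[OF i k] \<kappa>(3) p_ge by auto
    next
      case 3
      then have "k = i + 2" by (simp add: k_def)
      then have "h (cs ! i) = (i + 1) div 2" "h (cs ! k) = Suc ((i + 1) div 2)" "(i + 1) div 2 < p"
        using h_cs[OF i] h_cs[OF k] 3 by auto
      then show ?thesis using close[OF i k] \<kappa>(2)[of "(i + 1) div 2"] by auto
    qed
    then show ?thesis using same_cs[OF i k] unfolding k_def by (simp only:) simp
  qed
  have "two_chorded_value cs \<rho> = (\<Sum>i<?L. of_bool (odd i)) - (\<Sum>i<?L. 0)"
    unfolding two_chorded_value_eq[OF part finX]
    by (intro arg_cong2[where f = "(-)"] sum.cong refl) (simp_all only: s1 s2 lessThan_iff of_bool_eq simp_thms)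
  then have val: "two_chorded_value cs \<rho> = real p" by (simp only: sum_odd) simp
  have fibre: "{v \<in> X. h v = b} \<in> \<rho>" if b: "b \<in> B" and u: "\<And>b'. \<kappa> b' = \<kappa> b \<Longrightarrow> b' = b" for b
  proof -
    have "h v = b \<longleftrightarrow> g (h v) = g b" if "v \<in> X" for v
      using g(2)[of "h v" b] that b u unfolding B_def by blast
    then have "{v \<in> X. h v = b} = {v \<in> X. (g \<circ> h) v = g b}" by auto
    moreover have "g b \<in> (g \<circ> h) ` X" using b unfolding B_def by auto
    ultimately show ?thesis unfolding \<rho>_def by simp
  qed
  have fibre_cs: "{v \<in> X. h v = b} = {cs ! i | i. i < ?L \<and> (i + 1) div 2 = b}" if "b \<le> p" for b
  proof (intro set_eqI iffI)
    fix v assume "v \<in> {v \<in> X. h v = b}"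
    then have v: "h v = b" by simp
    then have "v \<in> set cs" using that h_out[of v] by fastforce
    then obtain i where "i < ?L" "v = cs ! i" using length_cs by (metis in_set_conv_nth)
    then show "v \<in> {cs ! i | i. i < ?L \<and> (i + 1) div 2 = b}" using v h_cs by auto
  next
    fix v assume "v \<in> {cs ! i | i. i < ?L \<and> (i + 1) div 2 = b}"
    then show "v \<in> {v \<in> X. h v = b}" using h_cs csX cs_in by auto
  qed
  have le_B: "b \<in> B" if "b \<le> p" for b using that sub by auto
  show ?thesis
  proof (rule that[of \<rho>])
    show "{cs ! 0} \<in> \<rho>" if "\<And>b. \<kappa> b = \<kappa> 0 \<Longrightarrow> b = 0"
    proof -
      have "(i < ?L \<and> (i + 1) div 2 = 0) \<longleftrightarrow> i = 0" for i by auto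
      then have "{cs ! i | i. i < ?L \<and> (i + 1) div 2 = 0} = {cs ! 0}" by simp
      then show ?thesis using fibre[OF le_B[of 0] that] fibre_cs[of 0] by simp
    qed
    show "block j \<in> \<rho>" if "1 \<le> j" "j \<le> p" "\<And>b. \<kappa> b = \<kappa> j \<Longrightarrow> b = j" for j
    proof -
      have "(i < ?L \<and> (i + 1) div 2 = j) \<longleftrightarrow> (i = 2 * j - 1 \<or> i = 2 * j)" for i
        using that(1,2) by auto
      then have "{cs ! i | i. i < ?L \<and> (i + 1) div 2 = j} = block j"
        unfolding block_def by auto
      then show ?thesis using fibre[OF le_B[OF that(2)] that(3)] fibre_cs[OF that(2)] by simp
    qed
    show "{u} \<in> \<rho>" if u: "u \<in> {1..n} - set cs - D" and uniq: "\<And>b. \<kappa> b = \<kappa> (p + 1 + u) \<Longrightarrow> b = p + 1 + u" for u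
    proof -
      have "h v \<le> p" if "v \<in> set cs" for v
      proof -
        from that obtain i where "i < ?L" "v = cs ! i" using length_cs by (metis in_set_conv_nth)
        then show ?thesis using h_cs[of i] by simp
      qed
      then have "h v = p + 1 + u \<longleftrightarrow> v = u" for v
        using u h_out[of v] by (cases "v \<in> set cs") fastforce+
      then have "{v \<in> X. h v = p + 1 + u} = {u}"
        using u unfolding X_def by auto
      moreover have "p + 1 + u \<in> B" using u sub unfolding X_def by auto
      ultimately show ?thesis using fibre[of "p + 1 + u"] uniq by simp
    qed
  qed (use part card\<rho> val X_def in auto)
qed

end

definition tight_partition :: "nat \<Rightarrow> nat \<Rightarrow> nat list \<Rightarrow> nat set \<Rightarrow> nat set set \<Rightarrow> bool" where
  "tight_partition K p cs X \<rho> \<longleftrightarrow>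
     partition_on X \<rho> \<and> card \<rho> = K \<and> two_chorded_value cs \<rho> = real p"

definition constant_on_tight ::
    "nat \<Rightarrow> nat \<Rightarrow> nat \<Rightarrow> nat list \<Rightarrow> (nat set \<Rightarrow> real) \<Rightarrow> real \<Rightarrow> bool" where
  "constant_on_tight n K p cs g b \<longleftrightarrow> (\<forall>\<pi>. tight_partition K p cs {1..n} \<pi> \<longrightarrow> sum g \<pi> = b)"

lemma tight_partition_rotate: "tight_partition K p (rotate k cs) = tight_partition K p cs"
  by (simp add: tight_partition_def two_chorded_value_def two_chorded_weight_rotate fun_eq_iff)

lemma constant_on_tight_rotate:
  "constant_on_tight n K p (rotate k cs) = constant_on_tight n K p cs"
  by (simp add: constant_on_tight_def tight_partition_rotate fun_eq_iff)

lemma tight_partition_add_vertex: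
  assumes t: "tight_partition K p cs X \<rho>" and fin: "finite X" and A: "A \<in> \<rho>"
    and v: "v \<notin> X" "v \<notin> set cs"
  shows "tight_partition K p cs (insert v X) (add_vertex v A \<rho>)"
proof -
  have \<rho>: "partition_on X \<rho>" using t by (simp add: tight_partition_def)
  have "inner_weight (two_chorded_weight cs) (insert v A) = inner_weight (two_chorded_weight cs) A"
    using partition_on_finite_parts(2)[OF \<rho> fin A] partition_on_fresh[OF \<rho> v(1) A] v(2)
    by (simp add: inner_weight_insert two_chorded_weight_outside)
  then show ?thesis
    using t add_vertex_partition[OF \<rho> fin A v(1)]
    by (simp add: tight_partition_def two_chorded_value_def)
qed

lemma tight_partition_merge:
  assumes t: "tight_partition K p cs X \<rho>" and fin: "finite X"
    and AB: "A \<in> \<rho>" "B \<in> \<rho>" "A \<noteq> B" and v: "v \<notin> X"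
    and cross: "cross_weight (two_chorded_weight cs) A B = 0"
  shows "tight_partition K p cs (insert v X) (insert {v} (merge_parts A B \<rho>))"
proof -
  have \<rho>: "partition_on X \<rho>" using t by (simp add: tight_partition_def)
  have "A \<inter> B = {}" using \<rho> AB by (auto simp: partition_on_def dest: disjointD)
  then have "inner_weight (two_chorded_weight cs) (A \<union> B) =
      inner_weight (two_chorded_weight cs) A + inner_weight (two_chorded_weight cs) B"
    using partition_on_finite_parts(2)[OF \<rho> fin] AB cross by (simp add: inner_weight_Un)
  then show ?thesis
    using t merge_parts_partition[OF \<rho> fin AB]
      insert_singleton_partition[OF merge_parts_partition(1)[OF \<rho> fin AB] fin v]
    by (simp add: tight_partition_def two_chorded_value_def)
qed

lemma constant_on_tight_place_two:
  assumes g: "constant_on_tight n K p cs g b"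
    and vx: "v \<in> {1..n} - set cs" "x \<in> {1..n} - set cs" "v \<noteq> x"
    and t: "tight_partition K p cs ({1..n} - {v, x}) \<rho>" and AB: "A \<in> \<rho>" "B \<in> \<rho>"
  shows "A \<noteq> B \<Longrightarrow> sum g \<rho> - g A - g B + g (insert v A) + g (insert x B) = b"
    and "sum g \<rho> - g A + g (insert x (insert v A)) = b"
proof -
  let ?X = "{1..n} - {v, x}"
  let ?\<rho> = "add_vertex v A \<rho>"
  have \<rho>: "partition_on ?X \<rho>" using t by (simp add: tight_partition_def)
  have ins: "insert v ?X = {1..n} - {x}" "insert x ({1..n} - {x}) = {1..n}" using vx by auto
  have t': "tight_partition K p cs ({1..n} - {x}) ?\<rho>"
    using tight_partition_add_vertex[OF t _ AB(1), of v, unfolded ins] vx by simp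
  then have \<rho>': "partition_on ({1..n} - {x}) ?\<rho>" by (simp add: tight_partition_def)
  have sum': "sum g ?\<rho> = sum g \<rho> - g A + g (insert v A)"
    using add_vertex_partition(3)[OF \<rho> _ AB(1)] by simp
  have *: "sum g ?\<rho> - g C + g (insert x C) = b" if C: "C \<in> ?\<rho>" for C
  proof -
    have "tight_partition K p cs {1..n} (add_vertex x C ?\<rho>)"
      using tight_partition_add_vertex[OF t' _ C, of x, unfolded ins] vx by simp
    then have "sum g (add_vertex x C ?\<rho>) = b" using g by (simp add: constant_on_tight_def)
    then show ?thesis using add_vertex_partition(3)[OF \<rho>' _ C] by simp
  qed
  show "sum g \<rho> - g A - g B + g (insert v A) + g (insert x B) = b" if "A \<noteq> B"
    using *[of B] that AB sum' by (auto simp: add_vertex_def)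
  show "sum g \<rho> - g A + g (insert x (insert v A)) = b"
    using *[of "insert v A"] sum' by (auto simp: add_vertex_def)
qed

lemma constant_on_tight_exchange:
  assumes "constant_on_tight n K p cs g b"
    and "v \<in> {1..n} - set cs" "x \<in> {1..n} - set cs" "v \<noteq> x"
    and "tight_partition K p cs ({1..n} - {v, x}) \<rho>" and "A \<in> \<rho>" "B \<in> \<rho>" "A \<noteq> B"
  shows "g (insert x (insert v A)) - g (insert v A) - g (insert x A) + g A
       + (g (insert x (insert v B)) - g (insert v B) - g (insert x B) + g B) = 0"
  using constant_on_tight_place_two[OF assms(1-5), of A B]
    constant_on_tight_place_two[OF assms(1-5), of B A] assms(6-8) by simp

lemma constant_on_tight_merge:
  assumes g: "constant_on_tight n K p cs g b"
    and x: "x \<in> {1..n} - set cs"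
    and t: "tight_partition K p cs ({1..n} - {x}) \<rho>" and AB: "A \<in> \<rho>" "B \<in> \<rho>" "A \<noteq> B"
    and cross: "cross_weight (two_chorded_weight cs) A B = 0"
  shows "g {x} + g (A \<union> B) - g B = g (insert x A)"
proof -
  let ?X = "{1..n} - {x}"
  have \<rho>: "partition_on ?X \<rho>" using t by (simp add: tight_partition_def)
  have ins: "insert x ?X = {1..n}" using x by auto
  have "tight_partition K p cs {1..n} (add_vertex x A \<rho>)"
    using tight_partition_add_vertex[OF t _ AB(1), of x, unfolded ins] x by simp
  moreover have "tight_partition K p cs {1..n} (insert {x} (merge_parts A B \<rho>))"
    using tight_partition_merge[OF t _ AB _ cross, of x, unfolded ins] by simp
  ultimately have "sum g (add_vertex x A \<rho>) = b" "sum g (insert {x} (merge_parts A B \<rho>)) = b"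
    using g by (auto simp: constant_on_tight_def)
  then show ?thesis
    using add_vertex_partition(3)[OF \<rho> _ AB(1), of x g]
      insert_singleton_partition(3)[OF merge_parts_partition(1)[OF \<rho> _ AB], of x g]
      merge_parts_partition(3)[OF \<rho> _ AB, of g]
    by simp
qed

lemma third_part:
  assumes "finite \<rho>" "3 \<le> card \<rho>"
  obtains B where "B \<in> \<rho>" "B \<noteq> P" "B \<noteq> Q"
proof -
  have "card {P, Q} \<le> 2" by (simp add: card_insert_if)
  then have "\<not> \<rho> \<subseteq> {P, Q}"
    using card_mono[of "{P, Q}" \<rho>] assms(2) by auto
  then show ?thesis using that by blast
qed

context odd_cycle
begin

lemma tight_partition_apex_block:
  assumes "D \<subseteq> {1..n} - set cs" "card D \<le> 2" "1 \<le> j" "j \<le> p"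
  obtains \<rho> where "tight_partition K p cs ({1..n} - D) \<rho>" "{cs ! 0} \<in> \<rho>" "block j \<in> \<rho>"
proof -
  define \<kappa> :: "nat \<Rightarrow> nat" where "\<kappa> b = (if b = 0 then 0 else if b = j then 1 else
    if b < j then (if even (b + p) then 2 else 3) else if b \<le> p then (if even b then 2 else 3) else 2)" for b
  have k1: "\<kappa> b < 4" for b by (simp add: \<kappa>_def)
  have k2: "\<kappa> i \<noteq> \<kappa> (Suc i)" if "i < p" for i
    using that assms(3,4) unfolding \<kappa>_def by auto
  have k3: "\<kappa> 0 \<noteq> \<kappa> p" and k4: "\<kappa> 1 \<noteq> \<kappa> p"
    using assms(3,4) p_ge unfolding \<kappa>_def by auto
  have "\<kappa> 0 = 0" by (simp add: \<kappa>_def)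
  moreover have "\<kappa> b \<noteq> 0" if "b \<noteq> 0" for b using that by (simp add: \<kappa>_def)
  ultimately have u1: "b = 0" if "\<kappa> b = \<kappa> 0" for b using that by metis
  have "\<kappa> j = 1" using assms(3) by (simp add: \<kappa>_def)
  moreover have "\<kappa> b \<noteq> 1" if "b \<noteq> j" for b using that by (simp add: \<kappa>_def)
  ultimately have u2: "b = j" if "\<kappa> b = \<kappa> j" for b using that by metis
  show ?thesis
    by (rule coloured_partition[OF assms(1,2) k1 k2 k3 k4], assumption, rule that)
      (use u1 u2 assms in \<open>auto simp: tight_partition_def\<close>)
qed

lemma tight_partition_outer_singleton:
  assumes "D \<subseteq> {1..n} - set cs" "card D \<le> 2" "u \<in> {1..n} - set cs - D"
  obtains \<rho> where "tight_partition K p cs ({1..n} - D) \<rho>" "{u} \<in> \<rho>"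
proof -
  define \<kappa> :: "nat \<Rightarrow> nat" where "\<kappa> b = (if b = p + 1 + u then 0 else if b = 1 then 1 else
    if b = 0 then 3 else if b \<le> p then (if even (b + p) then 2 else 3) else 2)" for b
  have k1: "\<kappa> b < 4" for b by (simp add: \<kappa>_def)
  have k2: "\<kappa> i \<noteq> \<kappa> (Suc i)" if "i < p" for i
    using that unfolding \<kappa>_def by auto
  have k3: "\<kappa> 0 \<noteq> \<kappa> p" and k4: "\<kappa> 1 \<noteq> \<kappa> p"
    using p_ge unfolding \<kappa>_def by auto
  have "\<kappa> (p + 1 + u) = 0" by (simp add: \<kappa>_def)
  moreover have "\<kappa> b \<noteq> 0" if "b \<noteq> p + 1 + u" for b using that by (simp add: \<kappa>_def)
  ultimately have u1: "b = p + 1 + u" if "\<kappa> b = \<kappa> (p + 1 + u)" for b using that by metis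
  show ?thesis
    by (rule coloured_partition[OF assms(1,2) k1 k2 k3 k4], assumption, rule that)
      (use u1 assms in \<open>auto simp: tight_partition_def\<close>)
qed

lemma tight_partition_two_blocks:
  assumes "D \<subseteq> {1..n} - set cs" "card D \<le> 2" "3 \<le> j" "j < p"
  obtains \<rho> where "tight_partition K p cs ({1..n} - D) \<rho>" "block 1 \<in> \<rho>" "block j \<in> \<rho>"
proof -
  define \<kappa> :: "nat \<Rightarrow> nat" where "\<kappa> b = (if b = 1 then 0 else if b = j then 1 else
    if b = 0 then 3 else if b \<le> p then (if even (b + p) then 2 else 3) else 2)" for b
  have k1: "\<kappa> b < 4" for b by (simp add: \<kappa>_def)
  have k2: "\<kappa> i \<noteq> \<kappa> (Suc i)" if "i < p" for i
    using that assms(3,4) unfolding \<kappa>_def by auto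
  have k3: "\<kappa> 0 \<noteq> \<kappa> p" and k4: "\<kappa> 1 \<noteq> \<kappa> p"
    using assms(3,4) p_ge unfolding \<kappa>_def by auto
  have "\<kappa> 1 = 0" by (simp add: \<kappa>_def)
  moreover have "\<kappa> b \<noteq> 0" if "b \<noteq> 1" for b using that by (simp add: \<kappa>_def)
  ultimately have u1: "b = 1" if "\<kappa> b = \<kappa> 1" for b using that by metis
  have "\<kappa> j = 1" using assms(3) by (simp add: \<kappa>_def)
  moreover have "\<kappa> b \<noteq> 1" if "b \<noteq> j" for b using that by (simp add: \<kappa>_def)
  ultimately have u2: "b = j" if "\<kappa> b = \<kappa> j" for b using that by metis
  show ?thesis
    by (rule coloured_partition[OF assms(1,2) k1 k2 k3 k4], assumption, rule that)
      (use u1 u2 assms p_ge in \<open>auto simp: tight_partition_def\<close>)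
qed

end

subsection \<open>Vanishing of functionals constant on tight partitions\<close>

lemma inner_weight_second_difference:
  assumes "finite S" "v \<notin> S" "x \<notin> S" "v \<noteq> x"
  shows "inner_weight w (insert x (insert v S)) - inner_weight w (insert v S)
    - inner_weight w (insert x S) + inner_weight w S = w {x, v}"
  using assms by (simp add: inner_weight_insert)

context odd_cycle
begin

lemma tight_partition_props:
  assumes "tight_partition K p cs X \<rho>" "finite X"
  shows "partition_on X \<rho>" "finite \<rho>" "3 \<le> card \<rho>" "A \<in> \<rho> \<Longrightarrow> finite A" "A \<in> \<rho> \<Longrightarrow> A \<noteq> {}"
    "A \<in> \<rho> \<Longrightarrow> A \<subseteq> X"
  using assms partition_on_finite_parts[of X \<rho>] K_ge
  by (auto simp: tight_partition_def partition_on_def)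

lemma rep_weight_zero:
  assumes g: "constant_on_tight n K p cs (\<lambda>S. inner_weight w S + r (Min S)) b"
    and r3: "\<And>v. v \<le> 3 \<Longrightarrow> r v = 0"
    and st: "s \<in> {1, 2, 3} - set cs" "t \<in> {1, 2, 3} - set cs" "s \<noteq> t"
    and v: "v \<le> n"
  shows "r v = 0"
proof (cases "v \<le> 3")
  case False
  have n: "8 \<le> n" using K_ge K_le p_ge by linarith
  have D: "{s, t} \<subseteq> {1..n} - set cs" "card {s, t} \<le> 2" using st n by auto
  have fin: "finite ({1..n} - {s, t})" by simp
  have vX: "v \<in> {1..n} - {s, t}" using False v st(1,2) by auto
  obtain \<rho> where \<rho>: "tight_partition K p cs ({1..n} - {s, t}) \<rho>" and v\<rho>: "{v} \<in> \<rho>"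
  proof (cases "v \<in> set cs")
    case True
    then obtain i where i: "i < length cs" "v = cs ! i" by (metis in_set_conv_nth)
    have "0 < length cs" using i(1) by linarith
    then have "rotate i cs ! 0 = v" using i nth_rotate[of 0 cs i] by simp
    moreover have "1 \<le> (1::nat)" "1 \<le> p" using p_ge by auto
    ultimately show ?thesis
      using odd_cycle.tight_partition_apex_block[OF rotate[of i], of "{s, t}" 1] D that
      by (metis set_rotate tight_partition_rotate)
  next
    case False
    then have "v \<in> {1..n} - set cs - {s, t}" using vX by auto
    then show ?thesis using tight_partition_outer_singleton[OF D] that by blast
  qed
  note props = tight_partition_props[OF \<rho> fin]
  obtain z where z: "{s, t, z} = {1, 2, 3}" "z \<noteq> s" "z \<noteq> t"
  proof -
    have "card {s, t} = 2" using st(3) by simp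
    then have "{s, t} \<noteq> {1, 2, 3}" by auto
    then obtain z where "z \<in> {1, 2, 3}" "z \<notin> {s, t}" using st(1,2) by blast
    moreover from this have "{s, t, z} = {1, 2, 3}" using st by auto
    ultimately show ?thesis using that by auto
  qed
  then have "z \<in> {1, 2, 3}" by blast
  then have "z \<in> {1..n} - {s, t}" using z n by auto
  then have "z \<in> \<Union> \<rho>" using partition_onD1[OF props(1)] by (simp only:)
  then obtain A where A: "A \<in> \<rho>" "z \<in> A" by blast
  have "Min A \<le> 3" using A props(4) \<open>z \<in> {1, 2, 3}\<close> Min_le[of A z] by fastforce
  then have rA: "r (Min A) = 0" by (rule r3)
  have "A \<noteq> {v}" using A False \<open>z \<in> {1, 2, 3}\<close> by auto
  obtain B where B: "B \<in> \<rho>" "B \<noteq> A" "B \<noteq> {v}" using third_part[OF props(2,3)] by metis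
  let ?g = "\<lambda>S. inner_weight w S + r (Min S)"
  have diff: "?g (insert t (insert s Y)) - ?g (insert s Y) - ?g (insert t Y) + ?g Y = w {t, s} + r (Min Y)"
    if Y: "Y \<in> \<rho>" for Y
  proof -
    have "Min (insert u Z) \<le> 3" if "u \<in> {1, 2, 3}" "finite Z" for u :: nat and Z
    proof -
      have "Min (insert u Z) \<le> u" using that(2) by (intro Min_le) auto
      then show ?thesis using that(1) by auto
    qed
    then have "Min (insert s Y) \<le> 3" "Min (insert t Y) \<le> 3" "Min (insert t (insert s Y)) \<le> 3"
      using st(1,2) props(4)[OF Y] by (simp_all only: DiffD1 finite_insert)
    moreover have "s \<notin> Y" "t \<notin> Y" using props(6)[OF Y] by auto
    ultimately show ?thesis
      using inner_weight_second_difference[of Y s t w] r3 props(4)[OF Y] st(3) by simp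
  qed
  have pair: "w {t, s} + r (Min Y) + (w {t, s} + r (Min Z)) = 0" if "Y \<in> \<rho>" "Z \<in> \<rho>" "Y \<noteq> Z" for Y Z
    using constant_on_tight_exchange[OF g _ _ st(3) \<rho> that] D(1) diff[OF that(1)] diff[OF that(2)]
    by auto
  have "r (Min {v}) = 0"
    using pair[OF A(1) v\<rho>] pair[OF A(1) B(1)] pair[OF B(1) v\<rho>] B \<open>A \<noteq> {v}\<close> rA by auto
  then show ?thesis by simp
qed (rule r3)

lemma constant_inner_weight:
  assumes g: "constant_on_tight n K p cs (\<lambda>S. inner_weight w S + r (Min S)) b"
    and r: "\<And>v. v \<le> n \<Longrightarrow> r v = 0"
  shows "constant_on_tight n K p cs (inner_weight w) b"
  unfolding constant_on_tight_def
proof (intro allI impI)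
  fix \<pi> assume \<pi>: "tight_partition K p cs {1..n} \<pi>"
  note props = tight_partition_props[OF this]
  have "inner_weight w S = inner_weight w S + r (Min S)" if "S \<in> \<pi>" for S
  proof -
    have "Min S \<in> S" using props(4,5)[OF _ that] by (intro Min_in) auto
    then have "Min S \<in> {1..n}" using props(6)[OF _ that] by blast
    then show ?thesis by (simp add: r)
  qed
  then show "sum (inner_weight w) \<pi> = b"
    using g \<pi> unfolding constant_on_tight_def by (metis (mono_tags, lifting) sum.cong)
qed

lemma outer_outer_weight_zero:
  assumes g: "constant_on_tight n K p cs (inner_weight w) b"
    and v: "v \<in> {1..n} - set cs" "x \<in> {1..n} - set cs" "v \<noteq> x"
  shows "w {v, x} = 0"
proof -
  have fin: "finite ({1..n} - {v, x})" by simp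
  have D: "{v, x} \<subseteq> {1..n} - set cs" "card {v, x} \<le> 2" using v by auto
  have "1 \<le> (1::nat)" "1 \<le> p" using p_ge by auto
  then obtain \<rho> where \<rho>: "tight_partition K p cs ({1..n} - {v, x}) \<rho>" "{cs ! 0} \<in> \<rho>"
    using tight_partition_apex_block[OF D] by metis
  note props = tight_partition_props[OF \<rho>(1) fin]
  obtain B where B: "B \<in> \<rho>" "B \<noteq> {cs ! 0}" using third_part[OF props(2,3)] by metis
  have "inner_weight w (insert x (insert v Y)) - inner_weight w (insert v Y)
    - inner_weight w (insert x Y) + inner_weight w Y = w {x, v}" if "Y \<in> \<rho>" for Y
    using inner_weight_second_difference[of Y v x w] props(4)[OF that] props(6)[OF that] v by auto
  from this[OF \<rho>(2)] this[OF B(1)]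
  have "w {x, v} + w {x, v} = 0"
    using constant_on_tight_exchange[OF g v \<rho>(1) \<rho>(2) B(1)] B(2) by simp
  then show ?thesis by (simp add: insert_commute)
qed

lemma first_notin_block: "1 \<le> j \<Longrightarrow> j \<le> p \<Longrightarrow> cs ! 0 \<notin> block j"
  using nth_cs_eq_iff[of 0 "2 * j - 1"] nth_cs_eq_iff[of 0 "2 * j"] by (auto simp: block_def)

text \<open>The vertex \<open>v\<close> has the same total weight towards every cluster; merging \<open>{cs ! 0}\<close> with
  \<open>block 1\<close> shows that this common weight equals its double.\<close>

lemma outer_first_weight_zero:
  assumes g: "constant_on_tight n K p cs (inner_weight w) b"
    and v: "v \<in> {1..n} - set cs" "x \<in> {1..n} - set cs" "v \<noteq> x"
  shows "w {v, cs ! 0} = 0"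
proof -
  let ?X = "{1..n} - {v, x}" and ?c = "{cs ! 0}" and ?P = "block 1"
  have fin: "finite ?X" by simp
  have D: "{v, x} \<subseteq> {1..n} - set cs" "card {v, x} \<le> 2" using v by auto
  have p1: "1 \<le> (1::nat)" "1 \<le> p" using p_ge by auto
  then obtain \<rho> where \<rho>: "tight_partition K p cs ?X \<rho>" "?c \<in> \<rho>" "?P \<in> \<rho>"
    using tight_partition_apex_block[OF D] by metis
  note props = tight_partition_props[OF \<rho>(1) fin]
  have cP: "?c \<noteq> ?P" using first_notin_block[OF p1] by auto
  obtain B where B: "B \<in> \<rho>" "B \<noteq> ?c" "B \<noteq> ?P" using third_part[OF props(2,3)] by metis
  define W where "W Y = (\<Sum>y\<in>Y. w {v, y})" for Y
  have vx0: "w {v, x} = 0" by (rule outer_outer_weight_zero[OF g v])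
  have ins: "inner_weight w (insert v Y) = inner_weight w Y + W Y"
    "inner_weight w (insert x (insert v Y)) = inner_weight w (insert x Y) + W Y" if "Y \<in> \<rho>" for Y
  proof -
    have "finite Y" "v \<notin> Y" "x \<notin> Y" using props(4,6)[OF that] by auto
    then show "inner_weight w (insert v Y) = inner_weight w Y + W Y"
        "inner_weight w (insert x (insert v Y)) = inner_weight w (insert x Y) + W Y"
      using v(3) vx0 unfolding W_def insert_commute[of x v]
      by (simp_all add: inner_weight_insert)
  qed
  have same: "W Y = W ?c" if "Y \<in> \<rho>" for Y
  proof (cases "Y = ?c")
    case False
    then show ?thesis
      using constant_on_tight_place_two(1)[OF g v \<rho>(1) \<rho>(2) that]
        constant_on_tight_place_two(2)[OF g v \<rho>(1) that that] ins that \<rho>(2) by fastforce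
  qed simp
  have X: "insert x ?X = {1..n} - {v}" "x \<notin> ?X" using v by auto
  let ?\<rho> = "insert {x} (merge_parts ?c ?P \<rho>)"
  have \<rho>': "tight_partition K p cs ({1..n} - {v}) ?\<rho>"
    using tight_partition_merge[OF \<rho>(1) fin \<rho>(2,3) cP X(2) two_chorded_cross_first_block[OF p1]]
    unfolding X(1) .
  have "insert v ({1..n} - {v}) = {1..n}" using v by auto
  then have "sum (inner_weight w) ?\<rho> - inner_weight w C + inner_weight w (insert v C) = b"
    if "C \<in> ?\<rho>" for C
    using tight_partition_add_vertex[OF \<rho>' _ that, of v] v(1) g
      add_vertex_partition(3)[of _ ?\<rho> C v "inner_weight w", OF tight_partition_props(1)[OF \<rho>'] _ that]
    by (simp add: constant_on_tight_def)
  from this[of B] this[of "?c \<union> ?P"]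
  have "inner_weight w (insert v B) - inner_weight w B
      = inner_weight w (insert v (?c \<union> ?P)) - inner_weight w (?c \<union> ?P)"
    using B by (simp add: merge_parts_def)
  moreover have "inner_weight w (insert v (?c \<union> ?P)) = inner_weight w (?c \<union> ?P) + (W ?c + W ?P)"
  proof -
    have "v \<notin> ?c \<union> ?P" "finite (?c \<union> ?P)" "?c \<inter> ?P = {}"
      using props(4,6)[OF \<rho>(2)] props(4,6)[OF \<rho>(3)] first_notin_block[OF p1] by auto
    then show ?thesis by (subst inner_weight_insert) (auto simp: W_def)
  qed
  ultimately have "W B = W ?c + W ?P" using ins(1)[OF B(1)] by simp
  then have "W ?c = 0" using same[OF B(1)] same[OF \<rho>(3)] by simp
  then show ?thesis by (simp add: W_def)
qed

lemma merge_cross_weight_zero: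
  assumes g: "constant_on_tight n K p cs (inner_weight w) b"
    and outer: "\<And>y. y \<in> {1..n} - {x} \<Longrightarrow> w {x, y} = 0"
    and x: "x \<in> {1..n} - set cs"
    and t: "tight_partition K p cs ({1..n} - {x}) \<rho>" and AB: "A \<in> \<rho>" "B \<in> \<rho>" "A \<noteq> B"
    and cross: "cross_weight (two_chorded_weight cs) A B = 0"
  shows "cross_weight w A B = 0"
proof -
  note props = tight_partition_props[OF t]
  have "A \<inter> B = {}" using props(1) AB by (auto simp: partition_on_def dest: disjointD)
  then have "inner_weight w (A \<union> B) = inner_weight w A + inner_weight w B + cross_weight w A B"
    using props(4) AB by (intro inner_weight_Un) auto
  moreover have "inner_weight w (insert x A) = inner_weight w A"
  proof -
    have "finite A" and A: "A \<subseteq> {1..n} - {x}" using props(4,6) AB(1) by auto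
    moreover have "(\<Sum>y\<in>A. w {x, y}) = 0" using A outer by (intro sum.neutral) blast
    ultimately show ?thesis by (subst inner_weight_insert) auto
  qed
  ultimately show ?thesis using constant_on_tight_merge[OF g x t AB cross] by simp
qed

lemma outer_weight_zero:
  assumes g: "constant_on_tight n K p cs (inner_weight w) b"
    and st: "s \<in> {1..n} - set cs" "t \<in> {1..n} - set cs" "s \<noteq> t"
    and x: "x \<in> {1..n} - set cs" and y: "y \<in> {1..n} - {x}"
  shows "w {x, y} = 0"
proof (cases "y \<in> set cs")
  case True
  then obtain i where i: "i < length cs" "y = cs ! i" by (metis in_set_conv_nth)
  have "0 < length cs" using i(1) by linarith
  then have "rotate i cs ! 0 = y" using i nth_rotate[of 0 cs i] by simp
  moreover obtain u where "u \<in> {1..n} - set cs" "x \<noteq> u" using st by metis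
  ultimately show ?thesis
    using odd_cycle.outer_first_weight_zero[OF rotate[of i], of w b x u] g x by (simp add: constant_on_tight_rotate)
next
  case False
  then show ?thesis using outer_outer_weight_zero[OF g x, of y] y by auto
qed

lemma apex_block_weights:
  assumes g: "constant_on_tight n K p cs (inner_weight w) b"
    and x: "x \<in> {1..n} - set cs" and outer: "\<And>y. y \<in> {1..n} - {x} \<Longrightarrow> w {x, y} = 0"
    and j: "1 \<le> j" "j \<le> p"
  shows "w {cs ! 0, cs ! (2 * j - 1)} + w {cs ! 0, cs ! (2 * j)} = 0"
proof -
  have "{x} \<subseteq> {1..n} - set cs" "card {x} \<le> 2" using x by auto
  then obtain \<rho> where \<rho>: "tight_partition K p cs ({1..n} - {x}) \<rho>" "{cs ! 0} \<in> \<rho>" "block j \<in> \<rho>"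
    using tight_partition_apex_block[OF _ _ j] by metis
  have "{cs ! 0} \<noteq> block j" using first_notin_block[OF j] by auto
  then have "cross_weight w {cs ! 0} (block j) = 0"
    using merge_cross_weight_zero[OF g outer x \<rho>] two_chorded_cross_first_block[OF j] by simp
  then show ?thesis by (simp add: cross_weight_block[OF j])
qed

lemma two_blocks_weights:
  assumes g: "constant_on_tight n K p cs (inner_weight w) b"
    and x: "x \<in> {1..n} - set cs" and outer: "\<And>y. y \<in> {1..n} - {x} \<Longrightarrow> w {x, y} = 0"
    and j: "3 \<le> j" "j < p"
  shows "w {cs ! 1, cs ! (2 * j - 1)} + w {cs ! 1, cs ! (2 * j)}
    + (w {cs ! 2, cs ! (2 * j - 1)} + w {cs ! 2, cs ! (2 * j)}) = 0"
proof -
  have "{x} \<subseteq> {1..n} - set cs" "card {x} \<le> 2" using x by auto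
  then obtain \<rho> where \<rho>: "tight_partition K p cs ({1..n} - {x}) \<rho>" "block 1 \<in> \<rho>" "block j \<in> \<rho>"
    using tight_partition_two_blocks[OF _ _ j] by metis
  have ne: "cs ! 1 \<noteq> cs ! (2 * j - 1)" "cs ! 1 \<noteq> cs ! (2 * j)" "cs ! 1 \<noteq> cs ! 2"
    using j nth_cs_eq_iff by auto
  then have "block 1 \<noteq> block j" by (auto simp: block_def)
  then have "cross_weight w (block 1) (block j) = 0"
    using merge_cross_weight_zero[OF g outer x \<rho>] two_chorded_cross_blocks[OF j] by simp
  moreover have "1 \<le> j" "j \<le> p" using j by auto
  moreover have "block 1 = {cs ! 1, cs ! 2}" by (simp add: block_def)
  ultimately have "(\<Sum>x\<in>{cs ! 1, cs ! 2}. w {x, cs ! (2 * j - 1)} + w {x, cs ! (2 * j)}) = 0"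
    using cross_weight_block[of j w "block 1"] by (simp only:)
  then show ?thesis using ne(3) by simp
qed

lemma cycle_weight_zero:
  assumes g: "constant_on_tight n K p cs (inner_weight w) b"
    and x: "x \<in> {1..n} - set cs" and outer: "\<And>y. y \<in> {1..n} - {x} \<Longrightarrow> w {x, y} = 0"
    and first: "w {cs ! 0, cs ! 1} = 0"
    and ik: "i < k" "k < 2 * p + 1"
  shows "w {cs ! i, cs ! k} = 0"
proof -
  let ?L = "2 * p + 1"
  define c where "c i = cs ! (i mod ?L)" for i
  define d where "d k m = w {c k, c (k + m)}" for k m
  have g_rot: "constant_on_tight n K p (rotate k cs) (inner_weight w) b" for k
    using g by (simp only: constant_on_tight_rotate)
  have x_rot: "x \<in> {1..n} - set (rotate k cs)" for k using x by simp
  have c_rot: "rotate k cs ! m = c (k + m)" if "m < ?L" for k m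
    using that length_cs by (simp add: c_def nth_rotate)
  have H1: "d k (2 * j) = - d k (2 * j - 1)" if "1 \<le> j" "j \<le> p" for k j
    using odd_cycle.apex_block_weights[OF rotate[of k] g_rot x_rot outer that]
      c_rot[of 0 k] c_rot[of "2 * j - 1" k] c_rot[of "2 * j" k] that
    by (simp add: d_def)
  have H2: "d (k + 1) (2 * (j - 1)) + d (k + 1) (2 * j - 1)
      + (d (k + 2) (2 * (j - 1) - 1) + d (k + 2) (2 * (j - 1))) = 0" if "3 \<le> j" "j < p" for k j
  proof -
    have shift: "k + 1 + 2 * (j - 1) = k + (2 * j - 1)" "k + 1 + (2 * j - 1) = k + 2 * j"
      "k + 2 + (2 * (j - 1) - 1) = k + (2 * j - 1)" "k + 2 + 2 * (j - 1) = k + 2 * j"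
      using that by auto
    have "rotate k cs ! 1 = c (k + 1)" "rotate k cs ! 2 = c (k + 2)"
      "rotate k cs ! (2 * j - 1) = c (k + (2 * j - 1))" "rotate k cs ! (2 * j) = c (k + 2 * j)"
      by (rule c_rot, use that in linarith)+
    then show ?thesis
      using odd_cycle.two_blocks_weights[OF rotate[of k] g_rot x_rot outer that] unfolding d_def shift by (simp only:)
  qed
  have period: "c (k + ?L) = c k" for k unfolding c_def by (simp only: mod_add_self2)
  have sym: "d k (2 * j) = d (k + 2 * j) (2 * (p + 1 - j) - 1)" if "1 \<le> j" "j \<le> p" for k j
  proof -
    have "k + 2 * j + (2 * (p + 1 - j) - 1) = k + ?L" using that by auto
    then have "d (k + 2 * j) (2 * (p + 1 - j) - 1) = w {c (k + 2 * j), c k}"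
      unfolding d_def by (simp only: period)
    then show ?thesis by (simp add: d_def insert_commute)
  qed
  have step: "d k (2 * j - 1) = d (k + 1) (2 * j - 1)" if "1 \<le> j" "j \<le> p" for k j
  proof -
    have "k + 2 * j + 2 * (p + 1 - j) = k + 1 + ?L" "k + 1 + (2 * j - 1) = k + 2 * j"
      using that by auto
    then have "d (k + 2 * j) (2 * (p + 1 - j)) = w {c (k + 2 * j), c (k + 1)}"
        "d (k + 1) (2 * j - 1) = w {c (k + 1), c (k + 2 * j)}"
      unfolding d_def by (simp_all only: period)
    then have "d (k + 2 * j) (2 * (p + 1 - j)) = d (k + 1) (2 * j - 1)"
      by (simp only: insert_commute)
    moreover have "1 \<le> p + 1 - j" "p + 1 - j \<le> p" using that by auto
    ultimately show ?thesis using H1[OF that, of k] sym[OF that, of k] H1[of "p + 1 - j" "k + 2 * j"] by simp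
  qed
  \<comment> \<open>The equations for a block and its reversal make \<open>d k m\<close> independent of the position \<open>k\<close>.\<close>
  define l where "l j = d 0 (2 * j - 1)" for j
  have odd_d: "d k (2 * j - 1) = l j" if "1 \<le> j" "j \<le> p" for k j
    using step[OF that] by (induction k) (simp_all add: l_def)
  have even_d: "d k (2 * j) = - l j" if "1 \<le> j" "j \<le> p" for k j
    using H1[OF that] odd_d[OF that] by simp
  have refl_l: "l (p + 1 - j) = - l j" if "1 \<le> j" "j \<le> p" for j
    using sym[OF that, of 0] even_d[OF that, of 0] odd_d[of "p + 1 - j" "0 + 2 * j"] that by simp
  have const_l: "l j = l 2" if "2 \<le> j" "j < p" for j
    using that
  proof (induction j rule: dec_induct)
    case (step j)
    have j: "3 \<le> Suc j" "Suc j < p" "1 \<le> j" "j \<le> p" "1 \<le> Suc j" "Suc j \<le> p" using step by auto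
    have "- l j + l (Suc j) + (l j + - l j) = 0"
      using H2[OF j(1,2), of 0] odd_d[OF j(3,4)] odd_d[OF j(5,6)] even_d[OF j(3,4)] by simp
    then show ?case using step by simp
  qed simp
  have l1: "l 1 = 0" using first p_ge by (simp add: l_def d_def c_def)
  then have lp: "l p = 0" using refl_l[of 1] p_ge by simp
  have l_zero: "l j = 0" if "1 \<le> j" "j \<le> p" for j
  proof (cases "j = 1 \<or> j = p")
    case False
    then have j: "2 \<le> j" "j < p" using that by auto
    then have "l (p - 1) = l 2" using const_l[of "p - 1"] by simp
    moreover have "l (p - 1) = - l 2" using refl_l[of 2] j by simp
    ultimately show ?thesis using const_l[OF j] by simp
  qed (use l1 lp in auto)
  have "d i (k - i) = 0"
  proof (cases "even (k - i)")
    case True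
    then obtain j where "k - i = 2 * j" by (rule evenE)
    then show ?thesis using even_d[of j i] l_zero[of j] ik by simp
  next
    case False
    then obtain j where "k - i = 2 * j + 1" by (rule oddE)
    then show ?thesis using odd_d[of "j + 1" i] l_zero[of "j + 1"] ik by simp
  qed
  then show ?thesis using ik by (simp add: d_def c_def)
qed

lemma tight_functional_zero:
  assumes g: "constant_on_tight n K p cs (\<lambda>S. inner_weight w S + r (Min S)) b"
    and r3: "\<And>v. v \<le> 3 \<Longrightarrow> r v = 0"
    and st: "s \<in> {1, 2, 3} - set cs" "t \<in> {1, 2, 3} - set cs" "s \<noteq> t"
    and first: "w {cs ! 0, cs ! 1} = 0"
  shows "v \<le> n \<Longrightarrow> r v = 0" and "e \<in> edges n \<Longrightarrow> w e = 0"
proof -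
  show r: "r v = 0" if "v \<le> n" for v by (rule rep_weight_zero[OF g r3 st that])
  have g': "constant_on_tight n K p cs (inner_weight w) b"
    by (rule constant_inner_weight[OF g]) (rule r)
  have "8 \<le> n" using K_ge K_le p_ge by linarith
  then have st': "s \<in> {1..n} - set cs" "t \<in> {1..n} - set cs" using st by auto
  note outer = outer_weight_zero[OF g' st' st(3)]
  have cyc: "w {cs ! i, cs ! k} = 0" if "i < k" "k < 2 * p + 1" for i k
    using cycle_weight_zero[OF g' st'(1) outer[OF st'(1)] first that] by simp
  show "w e = 0" if e: "e \<in> edges n" for e
  proof -
    obtain x y where xy: "e = {x, y}" "x \<noteq> y" "x \<in> {1..n}" "y \<in> {1..n}"
      using e by (auto simp: edges_def card_2_iff)
    consider "x \<notin> set cs" | "y \<notin> set cs" | "x \<in> set cs" "y \<in> set cs" by blast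
    then show ?thesis
    proof cases
      case 1
      then show ?thesis using outer[of x y] xy by simp
    next
      case 2
      then show ?thesis using outer[of y x] xy by (simp add: insert_commute)
    next
      case 3
      then obtain i k where ik: "i < 2 * p + 1" "x = cs ! i" "k < 2 * p + 1" "y = cs ! k"
        using length_cs by (metis in_set_conv_nth)
      then have "i \<noteq> k" using xy by blast
      then show ?thesis using cyc[of i k] cyc[of k i] ik xy
        by (cases "i < k") (auto simp: insert_commute)
    qed
  qed
qed

end

lemma (in odd_cycle) exists_tight_partition:
  obtains \<pi> where "tight_partition K p cs {1..n} \<pi>"
  using tight_partition_apex_block[of "{}" 1] p_ge by auto

subsection \<open>The facet\<close>

lemma inner_char_vec:
  fixes lab :: "'d::finite \<Rightarrow> coord"
  assumes lab: "coord_labelling n lab" and \<pi>: "partition_on {1..n} \<pi>"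
  shows "a \<bullet> char_vec lab \<pi> = (\<Sum>S\<in>\<pi>. inner_weight (\<lambda>e. entry lab a (Edge e)) S
     + (if 4 \<le> Min S then entry lab a (Rep (Min S)) else 0))"
proof -
  note fin = partition_on_finite_parts[OF \<pi> finite_atLeastAtMost]
  have bij: "bij_betw lab UNIV (coords n)" using lab by (simp add: coord_labelling_def)
  then have inv: "inv lab (lab d) = d" for d by (auto simp: bij_betw_def)
  have finE: "finite (edges n)"
    by (rule finite_subset[of _ "Pow {1..n}"]) (auto simp: edges_def)
  have "a \<bullet> char_vec lab \<pi> = (\<Sum>d\<in>UNIV. entry lab a (lab d) * char_coord \<pi> (lab d))"
    by (simp add: inner_vec_def char_vec_def entry_def inv)
  also have "\<dots> = (\<Sum>c\<in>coords n. entry lab a c * char_coord \<pi> c)"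
    by (rule sum.reindex_bij_betw[OF bij])
  also have "\<dots> = (\<Sum>e\<in>edges n. entry lab a (Edge e) * char_coord \<pi> (Edge e))
      + (\<Sum>u\<in>{4..n}. entry lab a (Rep u) * char_coord \<pi> (Rep u))"
    unfolding coords_def using finE
    by (subst sum.union_disjoint) (auto simp: sum.reindex inj_on_def)
  also have "(\<Sum>e\<in>edges n. entry lab a (Edge e) * char_coord \<pi> (Edge e))
      = (\<Sum>S\<in>\<pi>. inner_weight (\<lambda>e. entry lab a (Edge e)) S)"
  proof -
    have "(\<Sum>e\<in>edges n. entry lab a (Edge e) * char_coord \<pi> (Edge e))
        = (\<Sum>e\<in>edges n. \<Sum>S\<in>\<pi>. entry lab a (Edge e) * of_bool (e \<subseteq> S))"
    proof (intro sum.cong refl)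
      fix e assume "e \<in> edges n"
      then have "e \<noteq> {}" by (auto simp: edges_def)
      then show "entry lab a (Edge e) * char_coord \<pi> (Edge e)
          = (\<Sum>S\<in>\<pi>. entry lab a (Edge e) * of_bool (e \<subseteq> S))"
        using sum_of_bool_within_part[OF \<pi> fin(1), of e]
        by (simp add: sum_distrib_left[symmetric] of_bool_def del: sum_of_bool_eq)
    qed
    also have "\<dots> = (\<Sum>S\<in>\<pi>. \<Sum>e\<in>edges n. entry lab a (Edge e) * of_bool (e \<subseteq> S))"
      by (rule sum.swap)
    also have "\<dots> = (\<Sum>S\<in>\<pi>. inner_weight (\<lambda>e. entry lab a (Edge e)) S)"
    proof (intro sum.cong refl)
      fix S assume "S \<in> \<pi>"
      then have "S \<subseteq> {1..n}" using \<pi> by (auto simp: partition_on_def)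
      then have "{e. e \<subseteq> S \<and> card e = 2} = {e \<in> edges n. e \<subseteq> S}" by (auto simp: edges_def)
      then show "(\<Sum>e\<in>edges n. entry lab a (Edge e) * of_bool (e \<subseteq> S))
          = inner_weight (\<lambda>e. entry lab a (Edge e)) S"
        unfolding inner_weight_def using finE
        by (simp add: sum.inter_filter of_bool_def if_distrib cong: if_cong)
    qed
    finally show ?thesis .
  qed
  also have "(\<Sum>u\<in>{4..n}. entry lab a (Rep u) * char_coord \<pi> (Rep u))
      = (\<Sum>S\<in>\<pi>. if 4 \<le> Min S then entry lab a (Rep (Min S)) else 0)"
  proof -
    have part: "Min S \<in> S" "S \<subseteq> {1..n}" if "S \<in> \<pi>" for S
    proof -
      have "S \<noteq> {}" using that \<pi> by (auto simp: partition_on_def)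
      then show "Min S \<in> S" using fin(2)[OF that] by (rule Min_in[rotated])
      show "S \<subseteq> {1..n}" using that \<pi> by (auto simp: partition_on_def)
    qed
    have inj: "inj_on Min \<pi>"
    proof (rule inj_onI)
      fix S T assume ST: "S \<in> \<pi>" "T \<in> \<pi>" "Min S = Min T"
      then have "Min S \<in> S \<inter> T" using part(1)[of S] part(1)[of T] by simp
      then show "S = T" using \<pi> ST(1,2) by (auto simp: partition_on_def dest: disjointD)
    qed
    have "(\<Sum>u\<in>{4..n}. entry lab a (Rep u) * char_coord \<pi> (Rep u))
        = (\<Sum>u\<in>{4..n} \<inter> Min ` \<pi>. entry lab a (Rep u))"
      using part(1) by (intro sum.mono_neutral_cong_right) auto
    also have "{4..n} \<inter> Min ` \<pi> = Min ` {S \<in> \<pi>. 4 \<le> Min S}"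
      using part by fastforce
    also have "(\<Sum>u\<in>Min ` {S \<in> \<pi>. 4 \<le> Min S}. entry lab a (Rep u))
        = (\<Sum>S\<in>{S \<in> \<pi>. 4 \<le> Min S}. entry lab a (Rep (Min S)))"
      by (rule sum.reindex[unfolded comp_def]) (rule inj_on_subset[OF inj], auto)
    also have "\<dots> = (\<Sum>S\<in>\<pi>. if 4 \<le> Min S then entry lab a (Rep (Min S)) else 0)"
      using fin(1) by (rule sum.inter_filter)
    finally show ?thesis .
  qed
  finally show ?thesis by (simp add: sum.distrib)
qed

definition two_chorded_vec :: "('d::finite \<Rightarrow> coord) \<Rightarrow> nat list \<Rightarrow> real ^ 'd" where
  "two_chorded_vec lab cs = (\<chi> d. case lab d of Edge e \<Rightarrow> two_chorded_weight cs e | Rep u \<Rightarrow> 0)"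

lemma two_chorded_vec_entry:
  assumes "coord_labelling n lab" "c \<in> coords n"
  shows "entry lab (two_chorded_vec lab cs) c =
    (case c of Edge e \<Rightarrow> two_chorded_weight cs e | Rep u \<Rightarrow> 0)"
proof -
  have "lab (inv lab c) = c"
    using assms by (auto simp: coord_labelling_def bij_betw_def intro: f_inv_into_f)
  then show ?thesis by (simp add: entry_def two_chorded_vec_def)
qed

lemma two_chorded_lhs_inner:
  fixes lab :: "'d::finite \<Rightarrow> coord"
  assumes lab: "coord_labelling n lab"
    and edge: "\<And>i d. \<lbrakk>i < length cs; d = 1 \<or> d = 2\<rbrakk> \<Longrightarrow> {cs ! i, cs ! ((i + d) mod length cs)} \<in> edges n"
  shows "two_chorded_lhs lab cs x = two_chorded_vec lab cs \<bullet> x"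
proof -
  have bij: "bij_betw lab UNIV (coords n)" using lab by (simp add: coord_labelling_def)
  then have inj: "inj lab" by (simp add: bij_betw_def)
  have pick: "(\<Sum>d\<in>UNIV. of_bool (lab d = Edge e) * x $ d) = entry lab x (Edge e)"
    if "e \<in> edges n" for e
  proof -
    have "Edge e \<in> range lab" using that bij by (auto simp: bij_betw_def coords_def)
    then obtain d0 where d0: "lab d0 = Edge e" by auto
    then have "of_bool (lab d = Edge e) * x $ d = (if d = d0 then x $ d0 else 0)" for d
      using inj by (auto simp: inj_def)
    then show ?thesis using d0 inv_f_f[OF inj, of d0] by (simp add: entry_def)
  qed
  have "(case c of Edge e \<Rightarrow> two_chorded_weight cs e | Rep u \<Rightarrow> 0) =
      (\<Sum>i<length cs. of_bool (c = Edge {cs ! i, cs ! ((i + 1) mod length cs)}))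
    - (\<Sum>i<length cs. of_bool (c = Edge {cs ! i, cs ! ((i + 2) mod length cs)}))" for c
    by (cases c) (simp_all add: two_chorded_weight_def del: sum_of_bool_eq)
  then have "two_chorded_vec lab cs \<bullet> x =
      (\<Sum>d\<in>UNIV. \<Sum>i<length cs. of_bool (lab d = Edge {cs ! i, cs ! ((i + 1) mod length cs)}) * x $ d)
    - (\<Sum>d\<in>UNIV. \<Sum>i<length cs. of_bool (lab d = Edge {cs ! i, cs ! ((i + 2) mod length cs)}) * x $ d)"
    by (simp only: inner_vec_def two_chorded_vec_def vec_lambda_beta inner_real_def
      left_diff_distrib sum_distrib_right sum_subtractf)
  also have "\<dots> = two_chorded_lhs lab cs x"
    unfolding two_chorded_lhs_def
    by (subst (1 2) sum.swap) (intro arg_cong2[where f = "(-)"] sum.cong refl pick edge, auto)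
  finally show ?thesis by simp
qed

lemma aff_dim_ge_if_orthogonal_line:
  fixes F :: "'a::euclidean_space set"
  assumes x0: "x0 \<in> F" and line: "\<And>a. (\<And>x. x \<in> F \<Longrightarrow> a \<bullet> x = a \<bullet> x0) \<Longrightarrow> a \<in> span {c}"
  shows "int DIM('a) - 1 \<le> aff_dim F"
proof -
  let ?S = "(\<lambda>x. x - x0) ` F"
  let ?O = "{y \<in> UNIV. \<forall>x\<in>span ?S. orthogonal x y}"
  have "?O \<subseteq> span {c}"
  proof
    fix y assume "y \<in> ?O"
    then have "y \<bullet> x = y \<bullet> x0" if "x \<in> F" for x
      using that span_base[of "x - x0" ?S]
      by (auto simp: orthogonal_def inner_diff_left inner_diff_right inner_commute[of y])
    then show "y \<in> span {c}" by (rule line)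
  qed
  then have "dim ?O \<le> dim {c}" using dim_subset[of ?O "span {c}"] by (simp only: dim_span)
  moreover have "dim {c} \<le> 1" by (simp add: dim_singleton)
  moreover have "dim ?O + dim (span ?S) = DIM('a)"
    using dim_subspace_orthogonal_to_vectors[of "span ?S" UNIV] by simp
  moreover have "aff_dim F = int (dim ?S)"
    using x0 by (intro aff_dim_eq_dim_subtract hull_inc)
  ultimately show ?thesis by simp
qed

theorem theorem5p2:
  fixes n K p :: nat
    and lab :: "'d::finite \<Rightarrow> coord"
    and cs :: "nat list"
    and U :: "nat set"
  assumes "coord_labelling n lab"
    and "complete_graph_cycle n cs"
    and "length cs = 2 * p + 1"
    and "U = {1..n} - set cs"
    and "full_dimensional (partition_polytope lab n K)"
    and "card (U \<inter> {1, 2, 3}) \<ge> 2"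
    and "2 \<le> p"
    and "int p \<le> int n - int K - int (card (U \<inter> {1, 2, 3}))"
    and "K \<ge> 4"
  shows "two_chorded_face lab n K cs facet_of partition_polytope lab n K"
proof -
  have "K + p + 2 \<le> n" using assms(6,8) by linarith
  then interpret odd_cycle n K p cs
    using assms(2,3,7,9) unfolding complete_graph_cycle_def by unfold_locales simp_all
  let ?P = "partition_polytope lab n K" and ?F = "two_chorded_face lab n K cs"
  let ?A = "two_chorded_vec lab cs"
  let ?w = "\<lambda>a e. entry lab a (Edge e)"
  let ?r = "\<lambda>a v. if 4 \<le> v then entry lab a (Rep v) else (0 :: real)"
  have edge: "{cs ! i, cs ! ((i + d) mod length cs)} \<in> edges n"
    if "i < length cs" "d = 1 \<or> d = 2" for i d
  proof -
    have "(i + d) mod length cs < length cs" unfolding length_cs by simp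
    then have "{cs ! i, cs ! ((i + d) mod length cs)} \<subseteq> {1..n}"
      using that(1) cs_subset nth_mem[of _ cs] by blast
    then show ?thesis
      using card_cycle_pair[of i d] that unfolding length_cs edges_def by blast
  qed
  have lhs: "two_chorded_lhs lab cs x = ?A \<bullet> x" for x
    by (rule two_chorded_lhs_inner[OF assms(1)]) (rule edge)
  have lhs_char: "?A \<bullet> char_vec lab \<pi> = two_chorded_value cs \<pi>" if \<pi>: "partition_on {1..n} \<pi>" for \<pi>
    unfolding inner_char_vec[OF assms(1) \<pi>] two_chorded_value_def
  proof (intro sum.cong refl)
    fix S assume "S \<in> \<pi>"
    then have S: "S \<subseteq> {1..n}" "finite S" "S \<noteq> {}"
      using \<pi> partition_on_finite_parts[OF \<pi>] by (auto simp: partition_on_def)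
    have "inner_weight (?w ?A) S = inner_weight (two_chorded_weight cs) S"
      unfolding inner_weight_def
      using S by (intro sum.cong refl, subst two_chorded_vec_entry[OF assms(1)]) (auto simp: coords_def edges_def)
    moreover have "?r ?A (Min S) = 0"
    proof (cases "4 \<le> Min S")
      case True
      have "Min S \<in> {1..n}" using Min_in[OF S(2,3)] S(1) by blast
      then have "Rep (Min S) \<in> coords n" using True by (simp add: coords_def)
      then show ?thesis by (simp add: two_chorded_vec_entry[OF assms(1)])
    qed simp
    ultimately show "inner_weight (?w ?A) S + ?r ?A (Min S) = inner_weight (two_chorded_weight cs) S"
      by simp
  qed
  have floor: "of_int \<lfloor>real (length cs) / 2\<rfloor> = real p"
    unfolding length_cs by (simp add: floor_divide_of_nat_eq[of "2 * p + 1" 2, simplified])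
  have F_eq: "?F = ?P \<inter> {x. ?A \<bullet> x = real p}"
    by (auto simp: two_chorded_face_def lhs floor)
  have le: "?A \<bullet> x \<le> real p" if "x \<in> ?P" for x
  proof -
    have "char_vec lab ` {\<pi>. K_partition n K \<pi>} \<subseteq> {x. ?A \<bullet> x \<le> real p}"
      using lhs_char two_chorded_value_le by (auto simp: K_partition_def)
    then have "?P \<subseteq> {x. ?A \<bullet> x \<le> real p}"
      unfolding partition_polytope_def by (intro hull_minimal convex_halfspace_le)
    then show ?thesis using that by auto
  qed
  have face: "?F face_of ?P"
    unfolding F_eq by (rule face_of_Int_supporting_hyperplane_le) (auto simp: partition_polytope_def le)
  have tight_F: "char_vec lab \<pi> \<in> ?F" if "tight_partition K p cs {1..n} \<pi>" for \<pi>
    using that lhs_char unfolding F_eq tight_partition_def partition_polytope_def K_partition_def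
    by (auto intro: hull_inc)
  obtain \<pi>0 where \<pi>0: "tight_partition K p cs {1..n} \<pi>0" using exists_tight_partition by blast
  let ?x0 = "char_vec lab \<pi>0"
  have e01: "{cs ! 0, cs ! 1} \<in> edges n" using edge[of 0 1] length_cs p_ge by simp
  have A01: "?w ?A {cs ! 0, cs ! 1} = 1"
    using e01 two_chorded_weight_first_edge
    by (subst two_chorded_vec_entry[OF assms(1)]) (auto simp: coords_def)
  obtain s t where st: "s \<in> {1, 2, 3} - set cs" "t \<in> {1, 2, 3} - set cs" "s \<noteq> t"
  proof -
    obtain T where "T \<subseteq> U \<inter> {1, 2, 3}" "card T = 2"
      using obtain_subset_with_card_n[OF assms(6)] by metis
    moreover from this obtain s t where "T = {s, t}" "s \<noteq> t" by (auto simp: card_2_iff)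
    ultimately show ?thesis using that assms(4) by blast
  qed
  have line: "a \<in> span {?A}" if a: "\<And>x. x \<in> ?F \<Longrightarrow> a \<bullet> x = a \<bullet> ?x0" for a
  proof -
    define a' where "a' = a - ?w a {cs ! 0, cs ! 1} *\<^sub>R ?A"
    have const: "constant_on_tight n K p cs (\<lambda>S. inner_weight (?w a') S + ?r a' (Min S)) (a' \<bullet> ?x0)"
      unfolding constant_on_tight_def
    proof (intro allI impI)
      fix \<pi> assume \<pi>: "tight_partition K p cs {1..n} \<pi>"
      have "a' \<bullet> char_vec lab \<pi> = a' \<bullet> ?x0"
        using a[OF tight_F[OF \<pi>]] tight_F[OF \<pi>] tight_F[OF \<pi>0]
        by (simp add: a'_def inner_diff_left F_eq)
      moreover have "partition_on {1..n} \<pi>" using \<pi> by (simp add: tight_partition_def)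
      ultimately show "(\<Sum>S\<in>\<pi>. inner_weight (?w a') S + ?r a' (Min S)) = a' \<bullet> ?x0"
        using inner_char_vec[OF assms(1), of \<pi> a'] by simp
    qed
    have first: "?w a' {cs ! 0, cs ! 1} = 0"
      using A01 by (simp add: a'_def entry_def)
    have r_zero: "?r a' v = 0" if "v \<le> n" for v
      by (rule tight_functional_zero(1)[OF const _ st first that]) simp
    have w_zero: "?w a' e = 0" if "e \<in> edges n" for e
      by (rule tight_functional_zero(2)[OF const _ st first that]) simp
    have "a' = 0"
    proof (rule vec_eq_iff[THEN iffD2], rule allI)
      fix d
      have inv: "inv lab (lab d) = d" "lab d \<in> coords n"
        using assms(1) by (auto simp: coord_labelling_def bij_betw_def)
      have "entry lab a' c = 0" if "c \<in> coords n" for c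
      proof (cases c)
        case (Rep v)
        then show ?thesis using that r_zero[of v] by (auto simp: coords_def)
      qed (use that w_zero in \<open>auto simp: coords_def\<close>)
      from this[OF inv(2)] show "a' $ d = 0 $ d" by (simp add: entry_def inv(1))
    qed
    then have "a = ?w a {cs ! 0, cs ! 1} *\<^sub>R ?A" by (simp add: a'_def)
    then show ?thesis by (metis span_base span_scale singletonI)
  qed
  have "?A \<noteq> 0" using A01 by (auto simp: entry_def)
  then have "aff_dim ?F \<le> int DIM(real ^ 'd) - 1"
    using aff_dim_subset[of ?F "{x. ?A \<bullet> x = real p}"] aff_dim_hyperplane[of ?A "real p"] F_eq by auto
  moreover have "int DIM(real ^ 'd) - 1 \<le> aff_dim ?F"
    using aff_dim_ge_if_orthogonal_line[OF tight_F[OF \<pi>0] line] by simp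
  moreover have "aff_dim ?P = int DIM(real ^ 'd)" using assms(5) by (simp add: full_dimensional_def)
  ultimately show ?thesis unfolding facet_of_def using face tight_F[OF \<pi>0] by auto
qed

end
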